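(* Let $N\in\mathbb{N}$, $T>0$, let $a_2,a_{1,1},\dots,a_{1,N},a_0\in C([0,T];\mathbb{C})$ and let $A_2,A_{1,j},A_0$ be their primitives vanishing at $0$, i.e. $A_\bullet(t)=\int_0^t a_\bullet(s)\,ds$. For $f$ and $g$ as in (I) or (II) below, and for $t\in[0,T]$, $\xi\in\mathbb{Z}^N$, define $$\widehat u(t,\xi)=\widehat g(\xi)\exp\Big\{-i\Big[A_2(t)|\xi|^2+\sum_{j=1}^N A_{1,j}(t)\xi_j+A_0(t)\Big]\Big\}$$ $$\qquad+\,i\int_0^t\widehat f(s,\xi)\exp\Big\{i\Big[(A_2(s)-A_2(t))|\xi|^2+\sum_{j=1}^N(A_{1,j}(s)-A_{1,j}(t))\xi_j+(A_0(s)-A_0(t))\Big]\Big\}ds .$$ (I) Let $r\in\mathbb{R}$, $f\in C([0,T];H^r(\mathbb{T}^N))$ and $g\in H^r(\mathbb{T}^N)$. If there exist constants $C>0$, $\rho\ge0$ such that $$|\widehat u(t,\xi)|\le C(1+|\xi|)^\rho\Big[|\widehat g(\xi)|+\Big(\int_0^T|\widehat f(s,\xi)|^2ds\Big)^{1/2}\Big],\qquad\forall t\in[0,T],\ \forall\xi\in\mathbb{Z}^N,$$ then for each fixed $t\in[0,T]$ the series $u(t)=\sum_{\xi\in\mathbb{Z}^N}\widehat u(t,\xi)e^{ix\xi}$ defines an element of $H^{r-\rho}(\mathbb{T}^N)$, and $u\in C([0,T];H^{r-2-\rho}(\mathbb{T}^N))$. (II) Let $s\ge1$, $f\in C([0,T];G^s(\mathbb{T}^N))$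 and $g\in G^s(\mathbb{T}^N)$. If there exist $C,\delta>0$ such that $$|\widehat u(t,\xi)|\le Ce^{-\delta|\xi|^{1/s}},\qquad\forall t\in[0,T],\ \forall\xi\in\mathbb{Z}^N,$$ then $u=\sum_{\xi\in\mathbb{Z}^N}\widehat u(t,\xi)e^{ix\xi}$ belongs to $C([0,T];G^s(\mathbb{T}^N))$.
   Context: $\mathbb{T}^N=\mathbb{R}^N/2\pi\mathbb{Z}^N$. For a distribution $u$ on $\mathbb{T}^N$ its Fourier coefficients are $\widehat u(\xi)=\langle u,e^{-ix\xi}\rangle$, $\xi\in\mathbb{Z}^N$, normalized so that $u=\sum_\xi\widehat u(\xi)e^{ix\xi}$; for $f$ depending on $t$, $\widehat f(t,\xi)$ is the Fourier coefficient of $f(t)$. For $r\in\mathbb{R}$, $H^r(\mathbb{T}^N)$ is the set of distributions with $\|u\|_{H^r}^2=\sum_{\xi}|\widehat u(\xi)|^2(1+|\xi|)^{2r}<\infty$. For $s\ge1$, $G^s(\mathbb{T}^N)$ is the set of $f\in C^\infty(\mathbb{T}^N)$ for which there are $C,h>0$ with $|D^\alpha f(x)|\le Ch^{|\alpha|}|\alpha|!^s$ for all multi-indices $\alpha$ and all $x$. With $\|f\|_{h,s}=\sup_\alpha \|D^\alpha f\|_\infty/(h^{|\alpha|}|\alpha|!^s)$ and $G^s_h(\mathbb{T}^N)=\{f:\|f\|_{h,s}<\infty\}$, $G^s(\mathbb{T}^N)$ carries the (locally convex) inductive limit topology of the Banach spaces $G^s_h(\mathbb{T}^N)$, $h\to\infty$.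 $C([0,T];X)$ denotes the continuous maps $[0,T]\to X$. *)

theory Defs
  imports "HOL-Analysis.Analysis"
begin

text \<open>
  The dimension is \<open>N = CARD('n)\<close>. Functions on the torus are functions on \<open>real ^ 'n\<close> that are
  \<open>2 \<pi>\<close>-periodic in every coordinate; frequencies are vectors in \<open>int ^ 'n\<close>, and \<open>\<bar>\<xi>\<bar>\<close> is the
  Euclidean norm.
\<close>

definition freq :: "int ^ 'n \<Rightarrow> real ^ 'n::finite" where
  "freq \<xi> = (\<chi> j. real_of_int (\<xi> $ j))"

definition expi :: "int ^ 'n \<Rightarrow> real ^ 'n::finite \<Rightarrow> complex" where
  "expi \<xi> x = exp (\<i> * complex_of_real (x \<bullet> freq \<xi>))"


section \<open>Smooth functions on the torus\<close>

definition partial_deriv :: "'n \<Rightarrow> (real ^ 'n \<Rightarrow> complex) \<Rightarrow> real ^ 'n::finite \<Rightarrow> complex" where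
  "partial_deriv j f x = frechet_derivative f (at x) (axis j 1)"

fun partial_derivs :: "'n list \<Rightarrow> (real ^ 'n \<Rightarrow> complex) \<Rightarrow> real ^ 'n::finite \<Rightarrow> complex" where
  "partial_derivs [] f = f"
| "partial_derivs (j # js) f = partial_deriv j (partial_derivs js f)"

definition smooth_torus :: "(real ^ 'n::finite \<Rightarrow> complex) set" where
  "smooth_torus = {f. (\<forall>js x. partial_derivs js f differentiable (at x)) \<and>
                      (\<forall>k x. f (x + (2 * pi) *\<^sub>R freq k) = f x)}"

definition mi_order :: "('n::finite \<Rightarrow> nat) \<Rightarrow> nat" where
  "mi_order \<alpha> = (\<Sum>j\<in>UNIV. \<alpha> j)"

text \<open>
  The index type carries no order, so a list realising the multi-index \<open>\<alpha>\<close> is chosen arbitrarily;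
  for smooth functions mixed partial derivatives are symmetric and the choice does not matter.
\<close>

definition mi_deriv :: "('n \<Rightarrow> nat) \<Rightarrow> (real ^ 'n \<Rightarrow> complex) \<Rightarrow> real ^ 'n::finite \<Rightarrow> complex" where
  "mi_deriv \<alpha> f = partial_derivs (SOME js. \<forall>j. count_list js j = \<alpha> j) f"


section \<open>Distributions and Sobolev spaces\<close>

type_synonym 'n functional = "(real ^ 'n \<Rightarrow> complex) \<Rightarrow> complex"

text \<open>
  Distributions are the linear functionals on \<open>C\<^sup>\<infinity>\<close> that are continuous for the Frechet topology
  given by the sup-norms of all derivatives. They are made extensional, so that equality of
  distributions is equality on test functions.
\<close>

definition distributions :: "('n::finite) functional set" where
  "distributions = {u. u \<in> extensional smooth_torus \<and>
     (\<forall>\<phi>\<in>smooth_torus. \<forall>\<psi>\<in>smooth_torus. \<forall>a b.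
        u (\<lambda>x. a * \<phi> x + b * \<psi> x) = a * u \<phi> + b * u \<psi>) \<and>
     (\<exists>C k. \<forall>\<phi>\<in>smooth_torus.
        cmod (u \<phi>) \<le> C * (\<Sum>\<alpha> | mi_order \<alpha> \<le> k. SUP x. cmod (mi_deriv \<alpha> \<phi> x)))}"

definition fourier :: "('n::finite) functional \<Rightarrow> int ^ 'n \<Rightarrow> complex" where
  "fourier u \<xi> = u (\<lambda>x. exp (- (\<i> * complex_of_real (x \<bullet> freq \<xi>))))"

text \<open>
  The factor \<open>(2 \<pi>)\<^sup>-\<^sup>N\<close> in the embedding of functions into distributions is forced by the
  normalisation \<open>u = (\<Sum>\<xi>. fourier u \<xi> * expi \<xi>)\<close>.
\<close>

definition distr_of :: "(real ^ 'n \<Rightarrow> complex) \<Rightarrow> ('n::finite) functional" where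
  "distr_of f = (\<lambda>\<phi>\<in>smooth_torus.
     integral (cbox 0 (\<chi> j. 2 * pi)) (\<lambda>x. f x * \<phi> x) / complex_of_real ((2 * pi) ^ CARD('n)))"

text \<open>The series \<open>\<Sum>\<xi>. c \<xi> * expi \<xi>\<close> converges to \<open>u\<close> in the sense of distributions.\<close>

definition distr_sums :: "(int ^ 'n \<Rightarrow> complex) \<Rightarrow> ('n::finite) functional \<Rightarrow> bool" where
  "distr_sums c u \<longleftrightarrow> u \<in> distributions \<and>
     (\<forall>\<phi>\<in>smooth_torus. ((\<lambda>\<xi>. c \<xi> * distr_of (expi \<xi>) \<phi>) has_sum u \<phi>) UNIV)"

definition sobolev :: "real \<Rightarrow> ('n::finite) functional set" where
  "sobolev r = {u\<in>distributions.
     (\<lambda>\<xi>. (cmod (fourier u \<xi>))\<^sup>2 * (1 + norm (freq \<xi>)) powr (2 * r)) summable_on UNIV}"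

definition sobolev_norm :: "real \<Rightarrow> ('n::finite) functional \<Rightarrow> real" where
  "sobolev_norm r u =
     sqrt (\<Sum>\<^sub>\<infinity>\<xi>. (cmod (fourier u \<xi>))\<^sup>2 * (1 + norm (freq \<xi>)) powr (2 * r))"

definition sobolev_open :: "real \<Rightarrow> ('n::finite) functional set \<Rightarrow> bool" where
  "sobolev_open r V \<longleftrightarrow> V \<subseteq> sobolev r \<and>
     (\<forall>v\<in>V. \<exists>\<epsilon>>0. \<forall>w\<in>sobolev r. sobolev_norm r (\<lambda>\<phi>\<in>smooth_torus. w \<phi> - v \<phi>) < \<epsilon> \<longrightarrow> w \<in> V)"

definition sobolev_topology :: "real \<Rightarrow> ('n::finite) functional topology" where
  "sobolev_topology r = topology (sobolev_open r)"

lemma istopology_sobolev_open: "istopology (sobolev_open r)"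
  unfolding istopology_def
proof (intro conjI allI impI)
  fix V W :: "('n::finite) functional set"
  assume V: "sobolev_open r V" and W: "sobolev_open r W"
  show "sobolev_open r (V \<inter> W)"
    unfolding sobolev_open_def
  proof (intro conjI ballI)
    show "V \<inter> W \<subseteq> sobolev r"
      using V by (auto simp: sobolev_open_def)
    fix v assume v: "v \<in> V \<inter> W"
    from V v obtain d where d: "d > 0"
      "\<forall>w\<in>sobolev r. sobolev_norm r (\<lambda>\<phi>\<in>smooth_torus. w \<phi> - v \<phi>) < d \<longrightarrow> w \<in> V"
      unfolding sobolev_open_def by blast
    from W v obtain e where e: "e > 0"
      "\<forall>w\<in>sobolev r. sobolev_norm r (\<lambda>\<phi>\<in>smooth_torus. w \<phi> - v \<phi>) < e \<longrightarrow> w \<in> W"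
      unfolding sobolev_open_def by blast
    show "\<exists>\<epsilon>>0. \<forall>w\<in>sobolev r.
        sobolev_norm r (\<lambda>\<phi>\<in>smooth_torus. w \<phi> - v \<phi>) < \<epsilon> \<longrightarrow> w \<in> V \<inter> W"
      using d e by (intro exI[of _ "min d e"]) auto
  qed
next
  fix K :: "('n::finite) functional set set"
  assume K: "\<forall>V\<in>K. sobolev_open r V"
  show "sobolev_open r (\<Union>K)"
    unfolding sobolev_open_def
  proof (intro conjI ballI)
    show "\<Union>K \<subseteq> sobolev r"
      using K by (auto simp: sobolev_open_def)
    fix v assume "v \<in> \<Union>K"
    then obtain V where V: "V \<in> K" "v \<in> V" by blast
    with K obtain d where "d > 0"
      "\<forall>w\<in>sobolev r. sobolev_norm r (\<lambda>\<phi>\<in>smooth_torus. w \<phi> - v \<phi>) < d \<longrightarrow> w \<in> V"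
      unfolding sobolev_open_def by blast
    with V show "\<exists>\<epsilon>>0. \<forall>w\<in>sobolev r.
        sobolev_norm r (\<lambda>\<phi>\<in>smooth_torus. w \<phi> - v \<phi>) < \<epsilon> \<longrightarrow> w \<in> \<Union>K"
      by blast
  qed
qed

lemma openin_sobolev_topology: "openin (sobolev_topology r) V \<longleftrightarrow> sobolev_open r V"
  by (simp add: sobolev_topology_def istopology_sobolev_open)

lemma topspace_sobolev_topology: "topspace (sobolev_topology r) = sobolev r"
proof
  have "sobolev_open r (topspace (sobolev_topology r))"
    using openin_topspace openin_sobolev_topology by blast
  then show "topspace (sobolev_topology r) \<subseteq> sobolev r"
    unfolding sobolev_open_def by blast
  have "sobolev_open r (sobolev r)"
    by (auto simp: sobolev_open_def intro: exI[of _ 1])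
  then show "sobolev r \<subseteq> topspace (sobolev_topology r)"
    using openin_sobolev_topology openin_subset by blast
qed


section \<open>Gevrey spaces\<close>

definition gevrey :: "real \<Rightarrow> (real ^ 'n::finite \<Rightarrow> complex) set" where
  "gevrey s = {f\<in>smooth_torus. \<exists>C>0. \<exists>h>0. \<forall>\<alpha> x.
     cmod (mi_deriv \<alpha> f x) \<le> C * h ^ mi_order \<alpha> * fact (mi_order \<alpha>) powr s}"

definition gevrey_norm :: "real \<Rightarrow> real \<Rightarrow> (real ^ 'n::finite \<Rightarrow> complex) \<Rightarrow> ennreal" where
  "gevrey_norm h s f = (SUP \<alpha>. (SUP x. ennreal (cmod (mi_deriv \<alpha> f x))) /
     ennreal (h ^ mi_order \<alpha> * fact (mi_order \<alpha>) powr s))"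

definition gevrey_step :: "real \<Rightarrow> real \<Rightarrow> (real ^ 'n::finite \<Rightarrow> complex) set" where
  "gevrey_step h s = {f\<in>smooth_torus. gevrey_norm h s f < \<infinity>}"

text \<open>
  Zero neighbourhoods of the locally convex inductive limit: absolutely convex sets whose
  intersection with each step \<open>gevrey_step h s\<close> is a zero neighbourhood of that Banach space.
\<close>

definition gevrey_nhd0 :: "real \<Rightarrow> (real ^ 'n::finite \<Rightarrow> complex) set \<Rightarrow> bool" where
  "gevrey_nhd0 s U \<longleftrightarrow> U \<subseteq> gevrey s \<and>
     (\<forall>\<phi>\<in>U. \<forall>\<psi>\<in>U. \<forall>a b. cmod a + cmod b \<le> 1 \<longrightarrow> (\<lambda>x. a * \<phi> x + b * \<psi> x) \<in> U) \<and>
     (\<forall>h>0. \<exists>\<epsilon>>0. \<forall>\<phi>\<in>gevrey_step h s. gevrey_norm h s \<phi> < \<epsilon> \<longrightarrow> \<phi> \<in> U)"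

definition gevrey_open :: "real \<Rightarrow> (real ^ 'n::finite \<Rightarrow> complex) set \<Rightarrow> bool" where
  "gevrey_open s V \<longleftrightarrow> V \<subseteq> gevrey s \<and>
     (\<forall>v\<in>V. \<exists>U. gevrey_nhd0 s U \<and> (\<forall>\<phi>\<in>U. (\<lambda>x. v x + \<phi> x) \<in> V))"

definition gevrey_topology :: "real \<Rightarrow> (real ^ 'n::finite \<Rightarrow> complex) topology" where
  "gevrey_topology s = topology (gevrey_open s)"

lemma gevrey_nhd0_Int:
  assumes "gevrey_nhd0 s U" "gevrey_nhd0 s U'"
  shows "gevrey_nhd0 s (U \<inter> U')"
  unfolding gevrey_nhd0_def
proof (intro conjI allI impI)
  show "U \<inter> U' \<subseteq> gevrey s"
    using assms by (auto simp: gevrey_nhd0_def)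
  show "\<forall>\<phi>\<in>U \<inter> U'. \<forall>\<psi>\<in>U \<inter> U'. \<forall>a b. cmod a + cmod b \<le> 1 \<longrightarrow>
      (\<lambda>x. a * \<phi> x + b * \<psi> x) \<in> U \<inter> U'"
    using assms unfolding gevrey_nhd0_def by blast
  fix h :: real assume h: "h > 0"
  obtain d where d: "d > 0" "\<forall>\<phi>\<in>gevrey_step h s. gevrey_norm h s \<phi> < d \<longrightarrow> \<phi> \<in> U"
    using assms(1) h unfolding gevrey_nhd0_def by blast
  obtain e where e: "e > 0" "\<forall>\<phi>\<in>gevrey_step h s. gevrey_norm h s \<phi> < e \<longrightarrow> \<phi> \<in> U'"
    using assms(2) h unfolding gevrey_nhd0_def by blast
  show "\<exists>\<epsilon>>0. \<forall>\<phi>\<in>gevrey_step h s. gevrey_norm h s \<phi> < \<epsilon> \<longrightarrow> \<phi> \<in> U \<inter> U'"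
    using d e by (intro exI[of _ "min d e"]) auto
qed

lemma istopology_gevrey_open: "istopology (gevrey_open s)"
  unfolding istopology_def
proof (intro conjI allI impI)
  fix V W :: "(real ^ 'n::finite \<Rightarrow> complex) set"
  assume V: "gevrey_open s V" and W: "gevrey_open s W"
  show "gevrey_open s (V \<inter> W)"
    unfolding gevrey_open_def
  proof (intro conjI ballI)
    show "V \<inter> W \<subseteq> gevrey s"
      using V by (auto simp: gevrey_open_def)
    fix v assume v: "v \<in> V \<inter> W"
    from V v obtain A where A: "gevrey_nhd0 s A" "\<forall>\<phi>\<in>A. (\<lambda>x. v x + \<phi> x) \<in> V"
      unfolding gevrey_open_def by blast
    from W v obtain B where B: "gevrey_nhd0 s B" "\<forall>\<phi>\<in>B. (\<lambda>x. v x + \<phi> x) \<in> W"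
      unfolding gevrey_open_def by blast
    show "\<exists>U. gevrey_nhd0 s U \<and> (\<forall>\<phi>\<in>U. (\<lambda>x. v x + \<phi> x) \<in> V \<inter> W)"
      using A B gevrey_nhd0_Int[of s A B] by (intro exI[of _ "A \<inter> B"]) auto
  qed
next
  fix K :: "(real ^ 'n::finite \<Rightarrow> complex) set set"
  assume K: "\<forall>V\<in>K. gevrey_open s V"
  show "gevrey_open s (\<Union>K)"
    unfolding gevrey_open_def
  proof (intro conjI ballI)
    show "\<Union>K \<subseteq> gevrey s"
      using K by (auto simp: gevrey_open_def)
    fix v assume "v \<in> \<Union>K"
    then obtain V where V: "V \<in> K" "v \<in> V" by blast
    with K obtain A where "gevrey_nhd0 s A" "\<forall>\<phi>\<in>A. (\<lambda>x. v x + \<phi> x) \<in> V"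
      unfolding gevrey_open_def by blast
    with V show "\<exists>U. gevrey_nhd0 s U \<and> (\<forall>\<phi>\<in>U. (\<lambda>x. v x + \<phi> x) \<in> \<Union>K)"
      by blast
  qed
qed

lemma openin_gevrey_topology: "openin (gevrey_topology s) V \<longleftrightarrow> gevrey_open s V"
  by (simp add: gevrey_topology_def istopology_gevrey_open)


section \<open>The formal solution\<close>

definition C_interval :: "real \<Rightarrow> 'b topology \<Rightarrow> (real \<Rightarrow> 'b) set" where
  "C_interval T X = {f. continuous_map (top_of_set {0..T}) X f}"

definition primitive :: "(real \<Rightarrow> complex) \<Rightarrow> real \<Rightarrow> complex" where
  "primitive a t = integral {0..t} a"

definition u_hat ::
  "(real \<Rightarrow> complex) \<Rightarrow> ('n \<Rightarrow> real \<Rightarrow> complex) \<Rightarrow> (real \<Rightarrow> complex) \<Rightarrow>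
   (real \<Rightarrow> int ^ 'n \<Rightarrow> complex) \<Rightarrow> (int ^ 'n \<Rightarrow> complex) \<Rightarrow> real \<Rightarrow> int ^ 'n::finite \<Rightarrow> complex" where
  "u_hat a\<^sub>2 a\<^sub>1 a\<^sub>0 f_hat g_hat t \<xi> =
     (let A\<^sub>2 = primitive a\<^sub>2; A\<^sub>1 = (\<lambda>j. primitive (a\<^sub>1 j)); A\<^sub>0 = primitive a\<^sub>0 in
      g_hat \<xi> * exp (- \<i> * (A\<^sub>2 t * (norm (freq \<xi>))\<^sup>2 + (\<Sum>j\<in>UNIV. A\<^sub>1 j t * of_int (\<xi> $ j)) + A\<^sub>0 t))
      + \<i> * integral {0..t} (\<lambda>s. f_hat s \<xi> *
          exp (\<i> * ((A\<^sub>2 s - A\<^sub>2 t) * (norm (freq \<xi>))\<^sup>2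
                    + (\<Sum>j\<in>UNIV. (A\<^sub>1 j s - A\<^sub>1 j t) * of_int (\<xi> $ j)) + (A\<^sub>0 s - A\<^sub>0 t)))))"

end

theory Submission
  imports Defs
begin

text \<open>
  For each fixed frequency, \<open>t \<mapsto> u_hat t \<xi>\<close> is continuous, because the Fourier coefficients of \<open>f\<close>
  are continuous functionals on \<open>H\<^sup>r\<close> and on \<open>G\<^sup>s\<close>. The assumed bounds dominate the coefficients
  uniformly in \<open>t\<close>: in (I) by \<open>(1 + \<bar>\<xi>\<bar>)\<^sup>\<rho>\<close> times coefficients that are square summable with the
  weight of \<open>H\<^sup>r\<close> (as \<open>f\<close> is bounded in \<open>H\<^sup>r\<close> on the compact interval), in (II) by
  \<open>exp (- \<delta> \<bar>\<xi>\<bar>\<^bsup>1/s\<^esup>)\<close>, half of which controls a single Gevrey norm since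
  \<open>\<bar>\<xi>\<bar>\<^sup>k \<le> h\<^sup>k k!\<^sup>s exp (\<delta>/2 \<bar>\<xi>\<bar>\<^bsup>1/s\<^esup>)\<close>. Dominated convergence for sums over the lattice then
  yields continuity in \<open>t\<close>, in (I) even with values in \<open>H\<^bsup>r-\<rho>\<^esup>\<close>, so no time derivative of \<open>u\<close> is
  estimated. That polynomially bounded coefficients define a distribution rests on the decay of the
  Fourier coefficients of a test function, obtained by differentiating the translation identity
  \<open>\<integral> exp (i x \<xi>) \<phi>(x + h e\<^sub>j) dx = exp (- i h \<xi>\<^sub>j) \<integral> exp (i x \<xi>) \<phi>(x) dx\<close> in \<open>h\<close>.
\<close>

section \<open>Sums over the frequency lattice\<close>

abbreviation weight :: "int ^ 'n::finite \<Rightarrow> real" where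
  "weight \<xi> \<equiv> 1 + norm (freq \<xi>)"

lemma freq_nth [simp]: "freq \<xi> $ j = real_of_int (\<xi> $ j)"
  by (simp add: freq_def)

lemma freq_minus: "freq (- \<xi>) = - freq \<xi>"
  by (simp add: vec_eq_iff)

lemma abs_nth_le_norm_freq: "\<bar>real_of_int (\<xi> $ j)\<bar> \<le> norm (freq \<xi>)"
  using component_le_norm_cart[of "freq \<xi>" j] by simp

lemma weight_pos [simp]: "0 < weight \<xi>"
  by (simp add: add_pos_nonneg)

lemma weight_neq_0 [simp]: "weight \<xi> \<noteq> 0"
  using weight_pos[of \<xi>] by (rule less_imp_neq[symmetric])

lemma summable_int_inverse_square: "(\<lambda>m::int. 1 / (1 + \<bar>real_of_int m\<bar>) ^ 2) summable_on UNIV"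
proof -
  have N: "(\<lambda>n::nat. 1 / (1 + real n) ^ 2) summable_on UNIV"
    \<comment> \<open>The shift by \<open>Suc\<close> turns the sum of inverse squares, whose term
      at 0 is a default value, into the sum of 1/(1+n)^2.\<close>
    using inverse_power_summable[of 2, where 'a = real] summable_Suc_iff[of "\<lambda>n. inverse (real n ^ 2)"]
    by (subst summable_on_UNIV_nonneg_real_iff) (auto simp: field_simps)
  have "(\<lambda>m::int. 1 / (1 + \<bar>real_of_int m\<bar>) ^ 2) summable_on range int"
    using N by (subst summable_on_reindex) (auto simp: o_def)
  moreover have "(\<lambda>m::int. 1 / (1 + \<bar>real_of_int m\<bar>) ^ 2) summable_on range (\<lambda>n. - int n)"
    using N by (subst summable_on_reindex) (auto simp: o_def inj_on_def)
  ultimately have "(\<lambda>m::int. 1 / (1 + \<bar>real_of_int m\<bar>) ^ 2) summable_on (range int \<union> range (\<lambda>n. - int n))"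
    by (rule summable_on_union)
  moreover have "range int \<union> range (\<lambda>n. - int n) = UNIV"
    by (auto simp: image_def) (metis int_cases2)
  ultimately show ?thesis by simp
qed

text \<open>The exponent 2N provides one factor (1+|\<xi>|)^(-2) per coordinate. Each is at most
  (1+|\<xi>_j|)^(-2), so the majorant is a product of one-dimensional convergent series.\<close>

lemma summable_weight:
  assumes "m \<ge> 2 * CARD('n)"
  shows "(\<lambda>\<xi>::int ^ 'n::finite. 1 / weight \<xi> ^ m) summable_on UNIV"
proof (rule summable_on_comparison_test)
  define b :: "int \<Rightarrow> real" where "b = (\<lambda>m. 1 / (1 + \<bar>real_of_int m\<bar>) ^ 2)"
  have bs: "b summable_on UNIV" and b0: "b m \<ge> 0" for m
    unfolding b_def using summable_int_inverse_square by auto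
  show "(\<lambda>\<xi>::int ^ 'n. \<Prod>j\<in>UNIV. b (\<xi> $ j)) summable_on UNIV"
  proof (rule nonneg_bdd_above_summable_on)
    show "bdd_above (sum (\<lambda>\<xi>::int ^ 'n. \<Prod>j\<in>UNIV. b (\<xi> $ j)) ` {F. F \<subseteq> UNIV \<and> finite F})"
    proof (rule bdd_aboveI2)
      fix F :: "(int ^ 'n) set" assume "F \<in> {F. F \<subseteq> UNIV \<and> finite F}"
      then have F: "finite F" by simp
      \<comment> \<open>Enlarging \<open>F\<close> to the product of its coordinate projections
        makes the sum of products factor into a product of one-dimensional sums.\<close>
      define B where "B = (\<lambda>j. (\<lambda>\<xi>. \<xi> $ j) ` F)"
      have fB: "finite (B j)" for j using F by (simp add: B_def)
      have "(\<Sum>\<xi>\<in>F. \<Prod>j\<in>UNIV. b (\<xi> $ j)) = (\<Sum>g\<in>vec_nth ` F. \<Prod>j\<in>UNIV. b (g j))"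
        by (subst sum.reindex) (auto simp: inj_on_def vec_nth_inject)
      also have "\<dots> \<le> (\<Sum>g\<in>PiE UNIV B. \<Prod>j\<in>UNIV. b (g j))"
        by (rule sum_mono2) (auto simp: B_def fB intro!: finite_PiE prod_nonneg b0 F)
      also have "\<dots> = (\<Prod>j\<in>UNIV. \<Sum>y\<in>B j. b y)"
        by (rule prod_sum_PiE[symmetric]) (auto simp: fB)
      also have "\<dots> \<le> (\<Prod>j\<in>(UNIV::'n set). infsum b UNIV)"
        by (rule prod_mono) (auto intro!: sum_nonneg b0 finite_sum_le_infsum bs fB)
      finally show "(\<Sum>\<xi>\<in>F. \<Prod>j\<in>UNIV. b (\<xi> $ j)) \<le> (\<Prod>j\<in>(UNIV::'n set). infsum b UNIV)" .
    qed
  qed (auto intro: prod_nonneg b0)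
  fix \<xi> :: "int ^ 'n"
  have "1 / weight \<xi> ^ m \<le> 1 / weight \<xi> ^ (2 * CARD('n))"
    by (intro divide_left_mono power_increasing assms) (auto intro: mult_pos_pos)
  also have "\<dots> = (\<Prod>j\<in>(UNIV::'n set). 1 / weight \<xi> ^ 2)"
    by (simp add: power_mult power_one_over flip: power_mult)
  also have "\<dots> \<le> (\<Prod>j\<in>UNIV. b (\<xi> $ j))"
    unfolding b_def
    by (intro prod_mono conjI divide_left_mono power_mono add_left_mono abs_nth_le_norm_freq)
       (auto intro!: mult_pos_pos zero_less_power add_pos_nonneg)
  finally show "1 / weight \<xi> ^ m \<le> (\<Prod>j\<in>UNIV. b (\<xi> $ j))" .
qed auto

text \<open>The Weierstrass M-test makes the finite partial sums converge uniformly on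
  \<open>S\<close>, along the filter of finite subsets. A uniform limit may be exchanged with the
  limit t -> t0, and each finite sum tends to 0.\<close>

lemma tendsto_infsum_dominated:
  fixes F :: "'a \<Rightarrow> 'b::topological_space \<Rightarrow> real"
  assumes "\<And>x t. t \<in> S \<Longrightarrow> \<bar>F x t\<bar> \<le> g x" "g summable_on UNIV"
    and "\<And>x. (F x \<longlongrightarrow> 0) (at t0 within S)"
  shows "((\<lambda>t. \<Sum>\<^sub>\<infinity>x. F x t) \<longlongrightarrow> 0) (at t0 within S)"
proof (rule swap_uniform_limit)
  show "uniform_limit S (\<lambda>X t. \<Sum>x\<in>X. F x t) (\<lambda>t. \<Sum>\<^sub>\<infinity>x. F x t) (finite_subsets_at_top UNIV)"
    by (rule Weierstrass_m_test_general) (use assms in auto)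
  show "\<forall>\<^sub>F X in finite_subsets_at_top UNIV.
      ((\<lambda>t. \<Sum>x\<in>X. F x t) \<longlongrightarrow> 0) (at t0 within S)"
    using assms(3) by (intro always_eventually allI tendsto_null_sum) auto
qed auto

section \<open>Rapidly convergent trigonometric series\<close>

lemma expi_minus: "expi (- \<xi>) x = exp (- (\<i> * complex_of_real (x \<bullet> freq \<xi>)))"
  by (simp add: expi_def freq_minus)

lemma fourier_eq: "fourier u \<xi> = u (expi (- \<xi>))"
  by (simp add: fourier_def expi_minus[abs_def])

lemma norm_expi [simp]: "cmod (expi \<xi> x) = 1"
  by (simp add: expi_def norm_exp_i_times)

lemma expi_add: "expi \<xi> (x + y) = expi \<xi> x * expi \<xi> y"
  by (simp add: expi_def inner_add_left distrib_left exp_add)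

lemma continuous_on_expi [continuous_intros]:
  "continuous_on A f \<Longrightarrow> continuous_on A (\<lambda>x. expi \<xi> (f x))"
  unfolding expi_def by (intro continuous_intros)

lemma expi_periodic: "expi \<xi> ((2 * pi) *\<^sub>R freq k) = 1"
proof -
  have "((2 * pi) *\<^sub>R freq k) \<bullet> freq \<xi> = 2 * pi * of_int (\<Sum>j\<in>UNIV. k $ j * \<xi> $ j)"
    by (simp add: inner_vec_def sum_distrib_left mult.assoc)
  then show ?thesis
    unfolding expi_def using exp_integer_2pi[OF Ints_of_int, of "\<Sum>j\<in>UNIV. k $ j * \<xi> $ j"]
    by (simp only: of_real_mult of_real_numeral of_real_of_int_eq mult_ac)
qed

text \<open>Absolute summability against every polynomial weight is stable under multiplication by
  polynomials in \<xi>, hence under termwise differentiation of the series.\<close>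

definition rapid :: "(int ^ 'n::finite \<Rightarrow> complex) \<Rightarrow> bool" where
  "rapid c \<longleftrightarrow> (\<forall>k. (\<lambda>\<xi>. cmod (c \<xi>) * weight \<xi> ^ k) summable_on UNIV)"

definition trig_series :: "(int ^ 'n \<Rightarrow> complex) \<Rightarrow> real ^ 'n::finite \<Rightarrow> complex" where
  "trig_series c x = (\<Sum>\<^sub>\<infinity>\<xi>. c \<xi> * expi \<xi> x)"

lemma rapid_summable:
  assumes "rapid c" "\<And>\<xi>. norm (f \<xi> :: 'b::banach) \<le> K * cmod (c \<xi>) * weight \<xi> ^ k"
  shows "(\<lambda>\<xi>. norm (f \<xi>)) summable_on UNIV" "f summable_on UNIV"
proof -
  have "(\<lambda>\<xi>. K * (cmod (c \<xi>) * weight \<xi> ^ k)) summable_on UNIV"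
    using assms(1) unfolding rapid_def by (intro summable_on_cmult_right) auto
  then show "(\<lambda>\<xi>. norm (f \<xi>)) summable_on UNIV"
    by (rule Infinite_Sum.abs_summable_on_comparison_test') (use assms(2) in \<open>auto simp: mult_ac\<close>)
  then show "f summable_on UNIV" by (rule abs_summable_summable)
qed

lemma rapid_has_sum:
  assumes "rapid c"
  shows "((\<lambda>\<xi>. c \<xi> * expi \<xi> x) has_sum trig_series c x) UNIV"
  unfolding trig_series_def
  by (intro has_sum_infsum rapid_summable(2)[OF assms, of _ 1 0]) (auto simp: norm_mult)

lemma rapid_mult:
  assumes "rapid c" and p: "\<And>\<xi>. cmod (p \<xi>) \<le> weight \<xi> ^ m"
  shows "rapid (\<lambda>\<xi>. c \<xi> * p \<xi>)"
  unfolding rapid_def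
proof
  fix k
  show "(\<lambda>\<xi>. cmod (c \<xi> * p \<xi>) * weight \<xi> ^ k) summable_on UNIV"
  proof (rule rapid_summable(2)[OF assms(1), of _ 1 "m + k"])
    fix \<xi>
    have "cmod (c \<xi>) * cmod (p \<xi>) * weight \<xi> ^ k \<le> cmod (c \<xi>) * weight \<xi> ^ m * weight \<xi> ^ k"
      by (intro mult_right_mono mult_left_mono p) auto
    then show "norm (cmod (c \<xi> * p \<xi>) * weight \<xi> ^ k) \<le> 1 * cmod (c \<xi>) * weight \<xi> ^ (m + k)"
      by (simp add: norm_mult power_add mult_ac)
  qed
qed

text \<open>First-order Taylor remainder of exp. The argument is purely imaginary, so the factor
  exp|Re z| in that remainder equals 1.\<close>

lemma norm_exp_ii_Taylor1: "cmod (exp (\<i> * of_real x) - 1 - \<i> * of_real x) \<le> x\<^sup>2"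
  using Taylor_exp[of "\<i> * of_real x" 1]
  by (simp add: norm_mult power2_eq_square diff_diff_eq)

text \<open>Each term has a Taylor error of at most |v|^2 |c(\<xi>)| (1+|\<xi>|)^2. The sum of these
  is finite by \<open>rapid\<close>, so the whole series has a remainder of order |v|^2.\<close>

lemma trig_series_has_derivative:
  assumes c: "rapid c"
  shows "(trig_series c has_derivative
           (\<lambda>v. \<Sum>\<^sub>\<infinity>\<xi>. c \<xi> * (\<i> * of_real (v \<bullet> freq \<xi>)) * expi \<xi> x)) (at x)"
    (is "(_ has_derivative ?D) _")
proof -
  let ?d = "\<lambda>v \<xi>. c \<xi> * (\<i> * of_real (v \<bullet> freq \<xi>)) * expi \<xi> x"
  have nd: "cmod (?d v \<xi>) \<le> norm v * cmod (c \<xi>) * weight \<xi> ^ 1" for v \<xi>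
  proof -
    have "cmod (?d v \<xi>) = cmod (c \<xi>) * \<bar>v \<bullet> freq \<xi>\<bar>" by (simp add: norm_mult)
    also have "\<dots> \<le> cmod (c \<xi>) * (norm v * weight \<xi>)"
      by (intro mult_left_mono order_trans[OF Cauchy_Schwarz_ineq2] mult_left_mono) auto
    finally show ?thesis by (simp add: mult_ac)
  qed
  note dsum = rapid_summable[OF c nd]
  note esum = has_sum_imp_summable[OF rapid_has_sum[OF c]]
  \<comment> \<open>\<open>K\<close> controls the quadratic remainder, and \<open>L\<close> below
    bounds the operator norm of the candidate derivative.\<close>
  define K where "K = (\<Sum>\<^sub>\<infinity>\<xi>. cmod (c \<xi>) * weight \<xi> ^ 2)"
  define L where "L = (\<Sum>\<^sub>\<infinity>\<xi>. cmod (c \<xi>) * weight \<xi> ^ 1)"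
  have cs: "(\<lambda>\<xi>. cmod (c \<xi>) * weight \<xi> ^ k) summable_on UNIV" for k
    using c by (auto simp: rapid_def)
  have lin: "bounded_linear ?D"
  proof (rule bounded_linear_intro[where K = L])
    fix v w :: "real ^ 'a" and r :: real
    show "?D (v + w) = ?D v + ?D w"
      by (subst infsum_add[OF dsum(2) dsum(2), symmetric]) (simp add: inner_add_left algebra_simps)
    show "?D (r *\<^sub>R v) = r *\<^sub>R ?D v"
      by (subst infsum_scaleR_right[symmetric]) (simp only: inner_scaleR_left of_real_mult, simp add: scaleR_conv_of_real mult_ac)
    have "norm (?D v) \<le> (\<Sum>\<^sub>\<infinity>\<xi>. norm v * (cmod (c \<xi>) * weight \<xi> ^ 1))"
      by (rule norm_infsum_le[OF has_sum_infsum has_sum_infsum])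
         (use nd dsum(2) cs in \<open>simp_all only: mult.assoc summable_on_cmult_right\<close>)
    then show "norm (?D v) \<le> norm v * L"
      by (simp add: L_def infsum_cmult_right')
  qed
  have est: "cmod (trig_series c (x + v) - trig_series c x - ?D v) \<le> K * (norm v)\<^sup>2" for v
  proof -
    let ?e = "\<lambda>\<xi>. c \<xi> * expi \<xi> (x + v) - c \<xi> * expi \<xi> x - ?d v \<xi>"
    have "cmod (?e \<xi>) \<le> (norm v)\<^sup>2 * (cmod (c \<xi>) * weight \<xi> ^ 2)" for \<xi>
    proof -
      have "?e \<xi> = c \<xi> * expi \<xi> x *
          (exp (\<i> * of_real (v \<bullet> freq \<xi>)) - 1 - \<i> * of_real (v \<bullet> freq \<xi>))"
        unfolding expi_add by (simp add: expi_def[of \<xi> v] algebra_simps)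
      then have "cmod (?e \<xi>) \<le> cmod (c \<xi>) * (v \<bullet> freq \<xi>)\<^sup>2"
        using norm_exp_ii_Taylor1[of "v \<bullet> freq \<xi>"] by (simp add: norm_mult mult_left_mono)
      also have "\<dots> \<le> cmod (c \<xi>) * (norm v * weight \<xi>)\<^sup>2"
      proof (rule mult_left_mono)
        have "\<bar>v \<bullet> freq \<xi>\<bar> \<le> norm v * weight \<xi>"
          by (rule order_trans[OF Cauchy_Schwarz_ineq2]) (auto intro: mult_left_mono)
        then show "(v \<bullet> freq \<xi>)\<^sup>2 \<le> (norm v * weight \<xi>)\<^sup>2"
          by (metis abs_ge_zero power2_abs power_mono)
      qed auto
      finally show ?thesis by (simp add: power_mult_distrib mult_ac)
    qed
    moreover have "(?e has_sum (trig_series c (x + v) - trig_series c x - ?D v)) UNIV"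
      unfolding diff_conv_add_uminus
      by (intro has_sum_add has_sum_uminusI rapid_has_sum c has_sum_infsum dsum)
    moreover have "((\<lambda>\<xi>. (norm v)\<^sup>2 * (cmod (c \<xi>) * weight \<xi> ^ 2)) has_sum ((norm v)\<^sup>2 * K)) UNIV"
      unfolding K_def by (intro has_sum_cmult_right has_sum_infsum cs)
    ultimately show ?thesis using norm_infsum_le by (fastforce simp: mult_ac)
  qed
  show ?thesis
    unfolding has_derivative_at
  proof (intro conjI lin)
    have "((\<lambda>v. K * norm v) \<longlongrightarrow> 0) (at 0)"
      by (auto intro!: tendsto_eq_intros)
    then show "(\<lambda>v. norm (trig_series c (x + v) - trig_series c x - ?D v) / norm v) \<midarrow>0\<rightarrow> 0"
    proof (rule Lim_null_comparison[rotated])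
      show "\<forall>\<^sub>F v in at 0. norm (norm (trig_series c (x + v) - trig_series c x - ?D v) / norm v)
              \<le> K * norm v"
        using est by (auto simp: eventually_at field_simps power2_eq_square intro!: exI[of _ 1])
    qed
  qed
qed

lemma partial_deriv_trig_series:
  assumes "rapid c"
  shows "partial_deriv j (trig_series c) = trig_series (\<lambda>\<xi>. c \<xi> * (\<i> * of_int (\<xi> $ j)))"
proof
  fix x
  show "partial_deriv j (trig_series c) x = trig_series (\<lambda>\<xi>. c \<xi> * (\<i> * of_int (\<xi> $ j))) x"
    unfolding partial_deriv_def frechet_derivative_at[OF trig_series_has_derivative[OF assms], symmetric]
    by (simp add: trig_series_def inner_axis' )
qed

text \<open>The Fourier multiplier of \<open>partial_derivs js\<close>.\<close>

definition symbol :: "'n list \<Rightarrow> int ^ 'n::finite \<Rightarrow> complex" where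
  "symbol js \<xi> = (\<Prod>j\<leftarrow>js. \<i> * of_int (\<xi> $ j))"

lemma cmod_symbol_le: "cmod (symbol js \<xi>) \<le> norm (freq \<xi>) ^ length js"
proof (induction js)
  case (Cons j js)
  then show ?case
    using abs_nth_le_norm_freq[of \<xi> j]
    by (auto simp: symbol_def norm_mult intro!: mult_mono)
qed (simp add: symbol_def)

lemma cmod_symbol_le_weight: "cmod (symbol js \<xi>) \<le> weight \<xi> ^ length js"
  by (rule order_trans[OF cmod_symbol_le]) (auto intro: power_mono)

lemma partial_derivs_trig_series:
  assumes "rapid c"
  shows "partial_derivs js (trig_series c) = trig_series (\<lambda>\<xi>. c \<xi> * symbol js \<xi>)"
proof (induction js)
  case (Cons j js)
  then show ?case
    using partial_deriv_trig_series[OF rapid_mult[OF assms cmod_symbol_le_weight], of j js]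
    by (simp add: symbol_def mult_ac)
qed (simp add: symbol_def)

lemma trig_series_in_smooth_torus:
  assumes "rapid c"
  shows "trig_series c \<in> smooth_torus"
  unfolding smooth_torus_def
proof (intro CollectI conjI allI)
  show "partial_derivs js (trig_series c) differentiable at x" for js x
    unfolding partial_derivs_trig_series[OF assms] differentiable_def
    using trig_series_has_derivative[OF rapid_mult[OF assms cmod_symbol_le_weight]] by blast
  show "trig_series c (x + (2 * pi) *\<^sub>R freq k) = trig_series c x" for k x
    by (simp add: trig_series_def expi_add expi_periodic)
qed

text \<open>The bound keeps the power of |\<xi>| itself rather than of the weight, because
  \<open>power_le_exp_gevrey\<close> will be applied to it with a constant that has to be uniform in
  the order.\<close>

lemma cmod_partial_derivs_trig_series_le:
  assumes c: "rapid c"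
  shows "cmod (partial_derivs js (trig_series c) x)
    \<le> (\<Sum>\<^sub>\<infinity>\<xi>. cmod (c \<xi>) * norm (freq \<xi>) ^ length js)"
  unfolding partial_derivs_trig_series[OF c]
proof (rule norm_infsum_le[OF rapid_has_sum has_sum_infsum])
  show "rapid (\<lambda>\<xi>. c \<xi> * symbol js \<xi>)"
    by (rule rapid_mult[OF c cmod_symbol_le_weight])
  show "(\<lambda>\<xi>. cmod (c \<xi>) * norm (freq \<xi>) ^ length js) summable_on UNIV"
    by (rule rapid_summable(2)[OF c, of _ 1 "length js"])
       (auto simp: norm_mult norm_power intro!: mult_left_mono power_mono)
  show "cmod (c \<xi> * symbol js \<xi> * expi \<xi> x) \<le> cmod (c \<xi>) * norm (freq \<xi>) ^ length js" for \<xi>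
    using cmod_symbol_le by (auto simp: norm_mult intro!: mult_left_mono)
qed

text \<open>An exponential is a trigonometric series with one nonzero coefficient, so it inherits
  smoothness and periodicity from the general case.\<close>

lemma expi_in_smooth_torus: "expi \<xi> \<in> smooth_torus"
proof -
  define c where "c = (\<lambda>\<eta>. if \<eta> = \<xi> then 1 else 0 :: complex)"
  have "rapid c"
    unfolding rapid_def c_def
  proof
    show "(\<lambda>\<eta>. cmod (if \<eta> = \<xi> then 1 else 0) * weight \<eta> ^ k) summable_on UNIV" for k
      by (rule summable_on_cong_neutral[THEN iffD1, OF _ _ _ summable_on_finite[of "{\<xi>}"]]) auto
  qed
  moreover have "trig_series c = expi \<xi>"
    unfolding trig_series_def c_def
    by (rule ext, subst infsum_cong_neutral[where T = "{\<xi>}" and g = "\<lambda>\<eta>. expi \<eta> _"]) auto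
  ultimately show ?thesis using trig_series_in_smooth_torus by metis
qed

section \<open>Smooth functions on the torus\<close>

lemma smooth_torus_differentiable:
  "\<phi> \<in> smooth_torus \<Longrightarrow> partial_derivs js \<phi> differentiable at x"
  by (auto simp: smooth_torus_def)

lemma smooth_torus_continuous_on:
  "\<phi> \<in> smooth_torus \<Longrightarrow> continuous_on A (partial_derivs js \<phi>)"
  by (intro continuous_at_imp_continuous_on ballI differentiable_imp_continuous_within
      smooth_torus_differentiable)

lemma smooth_torus_periodic: "\<phi> \<in> smooth_torus \<Longrightarrow> \<phi> (x + (2 * pi) *\<^sub>R freq k) = \<phi> x"
  by (auto simp: smooth_torus_def)

lemma partial_derivs_append: "partial_derivs (js @ ks) \<phi> = partial_derivs js (partial_derivs ks \<phi>)"
  by (induction js) auto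

text \<open>Differentiability of all orders is inherited by concatenating lists. For periodicity,
  the chain rule with a translation by a period shows that the derivative at the translated point is
  also a derivative at \<open>x\<close>, and derivatives are unique.\<close>

lemma partial_derivs_in_smooth_torus:
  assumes "\<phi> \<in> smooth_torus"
  shows "partial_derivs js \<phi> \<in> smooth_torus"
proof (induction js)
  case (Cons j js)
  have "partial_deriv j (partial_derivs js \<phi>) (x + (2 * pi) *\<^sub>R freq k)
      = partial_deriv j (partial_derivs js \<phi>) x" for x k
  proof -
    let ?p = "(2 * pi) *\<^sub>R freq k"
    let ?f = "partial_derivs js \<phi>"
    have "(?f has_derivative frechet_derivative ?f (at (x + ?p))) (at (x + ?p))"
      using smooth_torus_differentiable[OF assms] frechet_derivative_works by blast
    then have "(?f \<circ> (\<lambda>x. x + ?p) has_derivative frechet_derivative ?f (at (x + ?p)) \<circ> (\<lambda>v. v)) (at x)"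
      by (intro diff_chain_at) (auto intro!: derivative_eq_intros)
    moreover have "?f \<circ> (\<lambda>x. x + ?p) = ?f"
      using smooth_torus_periodic[OF Cons] by (auto simp: o_def)
    ultimately have "(?f has_derivative frechet_derivative ?f (at (x + ?p))) (at x)"
      by (simp add: o_def)
    then have "frechet_derivative ?f (at (x + ?p)) = frechet_derivative ?f (at x)"
      by (rule frechet_derivative_at)
    then show ?thesis by (simp add: partial_deriv_def)
  qed
  moreover have "partial_derivs ks (partial_derivs (j # js) \<phi>) differentiable at x" for ks x
    unfolding partial_derivs_append[symmetric] by (rule smooth_torus_differentiable[OF assms])
  ultimately show ?case
    unfolding smooth_torus_def by simp
qed (use assms in simp)

lemma partial_derivs_linear:
  assumes "\<phi> \<in> smooth_torus" "\<psi> \<in> smooth_torus"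
  shows "partial_derivs js (\<lambda>x. a * \<phi> x + b * \<psi> x)
    = (\<lambda>x. a * partial_derivs js \<phi> x + b * partial_derivs js \<psi> x)"
proof (induction js)
  case (Cons j js)
  show ?case
  proof
    fix x
    have "((\<lambda>x. a * partial_derivs js \<phi> x + b * partial_derivs js \<psi> x) has_derivative
        (\<lambda>v. a * frechet_derivative (partial_derivs js \<phi>) (at x) v
           + b * frechet_derivative (partial_derivs js \<psi>) (at x) v)) (at x)"
      using smooth_torus_differentiable[OF assms(1)] smooth_torus_differentiable[OF assms(2)]
      by (intro has_derivative_add has_derivative_mult_right) (auto simp: frechet_derivative_works)
    from frechet_derivative_at[OF this]
    show "partial_derivs (j # js) (\<lambda>x. a * \<phi> x + b * \<psi> x) x
        = a * partial_derivs (j # js) \<phi> x + b * partial_derivs (j # js) \<psi> x"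
      by (simp add: Cons partial_deriv_def fun_eq_iff)
  qed
qed simp

lemma smooth_torus_linear:
  assumes "\<phi> \<in> smooth_torus" "\<psi> \<in> smooth_torus"
  shows "(\<lambda>x. a * \<phi> x + b * \<psi> x) \<in> smooth_torus"
  using assms
  by (auto simp: smooth_torus_def partial_derivs_linear[OF assms]
      intro!: differentiable_add differentiable_mult)

section \<open>Multi-indices realised by lists of directions\<close>

lemma ex_multi_index_list: "\<exists>js. \<forall>j. count_list js j = \<alpha> j" for \<alpha> :: "'n::finite \<Rightarrow> nat"
proof -
  have "finite A \<Longrightarrow> \<exists>js. \<forall>j. count_list js j = (if j \<in> A then \<alpha> j else 0)" for A
  proof (induction A rule: finite_induct)
    case (insert k A)
    then obtain js where js: "\<forall>j. count_list js j = (if j \<in> A then \<alpha> j else 0)" by blast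
    have "count_list (replicate n k) j = (if j = k then n else 0)" for n j
      by (induction n) auto
    then show ?case
      using js insert.hyps by (intro exI[of _ "replicate (\<alpha> k) k @ js"]) auto
  qed (auto intro: exI[of _ "[]"])
  from this[of UNIV] show ?thesis by simp
qed

text \<open>Unfolds the choice in \<open>mi_deriv\<close> once and for all. The list depends on
  \<alpha> only, so one list serves all functions and results on \<open>partial_derivs\<close>
  transfer.\<close>

lemma mi_deriv_list:
  obtains js where "\<And>j. count_list js j = \<alpha> j" "length js = mi_order \<alpha>"
    "\<And>\<phi>. mi_deriv \<alpha> \<phi> = partial_derivs js \<phi>"
proof -
  define js where "js = (SOME js. \<forall>j. count_list js j = \<alpha> j)"
  have c: "\<forall>j. count_list js j = \<alpha> j"
    unfolding js_def by (rule someI_ex[OF ex_multi_index_list])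
  have "(\<Sum>j\<in>UNIV. count_list js j) = length js"
    using sum_count_set[of js UNIV] by simp
  with c have "length js = mi_order \<alpha>" by (simp add: mi_order_def)
  with c show ?thesis using that by (auto simp: mi_deriv_def js_def)
qed

text \<open>For a multi-index supported in one coordinate only one list has the right counts, so the
  arbitrary choice in \<open>mi_deriv\<close> is known explicitly.\<close>

lemma mi_deriv_single: "mi_deriv (\<lambda>i. if i = j then k else 0) \<phi> = partial_derivs (replicate k j) \<phi>"
proof -
  obtain js where js: "\<And>i. count_list js i = (if i = j then k else 0)"
      "length js = mi_order (\<lambda>i. if i = j then k else 0)"
      "mi_deriv (\<lambda>i. if i = j then k else 0) \<phi> = partial_derivs js \<phi>"
    by (rule mi_deriv_list[of "\<lambda>i. if i = j then k else 0"]) blast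
  have "set js \<subseteq> {j}"
    using js(1) by (metis count_list_0_iff singleton_iff subsetI)
  then have "js = replicate (length js) j"
    by (metis replicate_length_same singletonD subsetD)
  moreover have "length js = k"
    using js(2) by (simp add: mi_order_def)
  ultimately show ?thesis using js(3) by simp
qed

lemma mi_deriv_zero: "mi_deriv (\<lambda>i. 0) \<phi> = \<phi>"
  \<comment> \<open>With exponent 0 any coordinate gives the zero multi-index, so an arbitrary one
    will do.\<close>
  using mi_deriv_single[of undefined 0 \<phi>] by (simp cong: if_cong)

lemma finite_mi_order_le: "finite {\<alpha> :: 'n::finite \<Rightarrow> nat. mi_order \<alpha> \<le> k}"
proof (rule finite_subset)
  show "{\<alpha> :: 'n \<Rightarrow> nat. mi_order \<alpha> \<le> k} \<subseteq> PiE UNIV (\<lambda>_. {..k})"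
  proof
    fix \<alpha> :: "'n \<Rightarrow> nat" assume "\<alpha> \<in> {\<alpha>. mi_order \<alpha> \<le> k}"
    then have "\<alpha> j \<le> k" for j
      using member_le_sum[of j UNIV \<alpha>] by (simp add: mi_order_def)
    then show "\<alpha> \<in> PiE UNIV (\<lambda>_. {..k})" by auto
  qed
qed (auto intro: finite_PiE)

section \<open>The period box and suprema of periodic functions\<close>

abbreviation torus_box :: "(real ^ 'n::finite) set" where
  "torus_box \<equiv> cbox 0 (\<chi> j. 2 * pi)"

lemma torus_box_representative:
  obtains k where "(x :: real ^ 'n::finite) + (2 * pi) *\<^sub>R freq k \<in> torus_box"
proof
  define k :: "int ^ 'n" where "k = (\<chi> j. - \<lfloor>x $ j / (2 * pi)\<rfloor>)"
  have "0 \<le> x $ j - 2 * pi * \<lfloor>x $ j / (2 * pi)\<rfloor>" "x $ j - 2 * pi * \<lfloor>x $ j / (2 * pi)\<rfloor> \<le> 2 * pi" for j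
    using floor_divide_lower[of "2 * pi" "x $ j"] floor_divide_upper[of "2 * pi" "x $ j"]
    by (auto simp: algebra_simps)
  then show "x + (2 * pi) *\<^sub>R freq k \<in> torus_box"
    by (auto simp: mem_box_cart k_def)
qed

text \<open>By periodicity all values are attained on the compact period box. This ensures that the
  real suprema in the definition of \<open>distributions\<close> really are upper bounds.\<close>

lemma smooth_torus_bdd_above:
  fixes \<phi> :: "real ^ 'n::finite \<Rightarrow> complex"
  assumes "\<phi> \<in> smooth_torus"
  shows "bdd_above (range (\<lambda>x. cmod (\<phi> x)))"
proof -
  have "compact ((\<lambda>x. cmod (\<phi> x)) ` torus_box)"
    using smooth_torus_continuous_on[OF assms, of _ "[]"]
    by (intro compact_continuous_image continuous_intros) auto
  then have "bdd_above ((\<lambda>x. cmod (\<phi> x)) ` torus_box)"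
    by (intro bounded_imp_bdd_above compact_imp_bounded)
  moreover have "range (\<lambda>x. cmod (\<phi> x)) \<subseteq> (\<lambda>x. cmod (\<phi> x)) ` torus_box"
  proof clarify
    fix x :: "real ^ 'n"
    obtain k where "x + (2 * pi) *\<^sub>R freq k \<in> torus_box" by (rule torus_box_representative)
    then show "cmod (\<phi> x) \<in> (\<lambda>x. cmod (\<phi> x)) ` torus_box"
      using smooth_torus_periodic[OF assms, of x k] by (metis imageI)
  qed
  ultimately show ?thesis by (rule bdd_above_mono)
qed

lemma cmod_le_SUP_smooth_torus:
  "\<phi> \<in> smooth_torus \<Longrightarrow> cmod (\<phi> x) \<le> (SUP x. cmod (\<phi> x))"
  by (intro cSUP_upper smooth_torus_bdd_above) auto

section \<open>Fourier coefficients of smooth functions\<close>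

lemma split_box_at:
  fixes a b :: "real ^ 'n::finite"
  assumes "a $ j \<le> c" "c \<le> b $ j" "continuous_on UNIV (f :: _ \<Rightarrow> complex)"
  shows "integral (cbox a b) f
    = integral (cbox a (\<chi> i. if i = j then c else b $ i)) f
    + integral (cbox (\<chi> i. if i = j then c else a $ i) b) f"
proof -
  have f: "f integrable_on cbox a b"
    using assms(3) continuous_on_subset by (intro integrable_continuous) blast
  have k: "axis j 1 \<in> (Basis :: (real ^ 'n) set)"
    by (simp add: axis_in_Basis_iff)
  have "cbox a b \<inter> {x. x \<bullet> axis j 1 \<le> c} = cbox a (\<chi> i. if i = j then c else b $ i)"
    using assms(1,2) by (intro set_eqI) (simp add: mem_box_cart inner_axis, smt (verit))
  moreover have "cbox a b \<inter> {x. x \<bullet> axis j 1 \<ge> c} = cbox (\<chi> i. if i = j then c else a $ i) b"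
    using assms(1,2) by (intro set_eqI) (simp add: mem_box_cart inner_axis, smt (verit))
  ultimately show ?thesis
    using integral_split[OF f k, of c] by simp
qed

text \<open>The translated box is cut at x_j = 2 pi. The part that sticks out is moved back by one
  period and becomes the slab 0 <= x_j <= h, which is exactly the part that the translation had
  removed.\<close>

lemma torus_integral_translate:
  fixes f :: "real ^ 'n::finite \<Rightarrow> complex"
  assumes f: "continuous_on UNIV f" and per: "\<And>x. f (x + (2 * pi) *\<^sub>R axis j 1) = f x"
    and h: "0 \<le> h" "h \<le> 2 * pi"
  shows "integral torus_box (\<lambda>x. f (x + h *\<^sub>R axis j 1)) = integral torus_box f"
proof -
  let ?e = "axis j 1 :: real ^ 'n" and ?p = "(\<chi> j. 2 * pi) :: real ^ 'n"
  have shift: "integral (cbox a b) (\<lambda>x. f (x + c)) = integral (cbox (a + c) (b + c)) f" for a b c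
    using integral_shift_cbox[of "a + c" c "b + c" f] by simp
  \<comment> \<open>These are the corners of the pieces cut off at x_j = 2 pi and x_j = h. The last
    identity exhibits the upper corner of the protruding piece as a translate by one period.\<close>
  have eqs: "(\<chi> i. if i = j then 2 * pi else (?p + h *\<^sub>R ?e) $ i) = ?p"
      "(\<chi> i. if i = j then 2 * pi else (h *\<^sub>R ?e) $ i) = (2 * pi) *\<^sub>R ?e"
      "(\<chi> i. if i = j then h else (0 :: real ^ 'n) $ i) = h *\<^sub>R ?e"
      "?p + h *\<^sub>R ?e = (\<chi> i. if i = j then h else ?p $ i) + (2 * pi) *\<^sub>R ?e"
    by (auto simp: vec_eq_iff axis_def)
  have "integral torus_box (\<lambda>x. f (x + h *\<^sub>R ?e)) = integral (cbox (h *\<^sub>R ?e) (?p + h *\<^sub>R ?e)) f"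
    using shift[of 0 ?p] by simp
  also have "\<dots> = integral (cbox (h *\<^sub>R ?e) ?p) f
      + integral (cbox ((2 * pi) *\<^sub>R ?e) (?p + h *\<^sub>R ?e)) f"
    using split_box_at[of "h *\<^sub>R ?e" j "2 * pi" "?p + h *\<^sub>R ?e" f] h f
    by (simp only: eqs(1-3)) simp
  also have "integral (cbox ((2 * pi) *\<^sub>R ?e) (?p + h *\<^sub>R ?e)) f
      = integral (cbox 0 (\<chi> i. if i = j then h else ?p $ i)) f"
    unfolding eqs(4) using shift[of 0 "\<chi> i. if i = j then h else ?p $ i" "(2 * pi) *\<^sub>R ?e"]
    by (simp add: per)
  also have "integral (cbox (h *\<^sub>R ?e) ?p) f + \<dots> = integral torus_box f"
    using split_box_at[of 0 j h ?p f] h f by (simp only: eqs(1-3)) simp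
  finally show ?thesis .
qed

lemma axis_eq_freq: "axis j 1 = freq (axis j 1)"
  by (simp add: vec_eq_iff axis_def)

text \<open>Translation invariance is applied to the product of \<open>expi \<xi>\<close> and
  \<phi>. Since \<open>expi \<xi>\<close> is a character, its translation only contributes a
  constant factor.\<close>

lemma torus_integral_expi_translate:
  assumes "\<phi> \<in> smooth_torus" "0 \<le> h" "h \<le> 2 * pi"
  shows "integral torus_box (\<lambda>x. expi \<xi> x * \<phi> (x + h *\<^sub>R axis j 1))
    = expi \<xi> (- h *\<^sub>R axis j 1) * integral torus_box (\<lambda>x. expi \<xi> x * \<phi> x)"
proof -
  let ?f = "\<lambda>x. expi \<xi> x * \<phi> x"
  have "expi \<xi> (h *\<^sub>R axis j 1) * expi \<xi> (- h *\<^sub>R axis j 1) = 1"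
    by (simp add: expi_def flip: expi_add) (simp add: expi_def flip: exp_add)
  then have eq: "expi \<xi> x * \<phi> (x + h *\<^sub>R axis j 1)
      = expi \<xi> (- h *\<^sub>R axis j 1) * ?f (x + h *\<^sub>R axis j 1)" for x
    by (simp add: expi_add mult_ac)
  have "integral torus_box (\<lambda>x. ?f (x + h *\<^sub>R axis j 1)) = integral torus_box ?f"
  proof (rule torus_integral_translate)
    show "continuous_on UNIV ?f"
      using smooth_torus_continuous_on[OF assms(1), of _ "[]"] by (auto intro!: continuous_intros)
    show "?f (x + (2 * pi) *\<^sub>R axis j 1) = ?f x" for x
      by (simp add: expi_add axis_eq_freq expi_periodic smooth_torus_periodic[OF assms(1)])
  qed (use assms in auto)
  then show ?thesis by (simp only: eq integral_mult_right)
qed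

text \<open>Integration by parts on the torus, with periodicity entering through the translation
  identity. Both sides of that identity are differentiated at h = 0: the left under the integral
  sign, the right as an explicit exponential.\<close>

lemma distr_of_expi_partial_deriv:
  assumes \<phi>: "\<phi> \<in> smooth_torus"
  shows "distr_of (expi \<xi>) (partial_deriv j \<phi>) = - (\<i> * of_int (\<xi> $ j)) * distr_of (expi \<xi>) \<phi>"
proof -
  define I where "I = integral torus_box (\<lambda>x. expi \<xi> x * \<phi> x)"
  have cont: "continuous_on A (partial_deriv j \<phi>)" "continuous_on A \<phi>" for A
    using smooth_torus_continuous_on[OF \<phi>, of _ "[j]"] smooth_torus_continuous_on[OF \<phi>, of _ "[]"]
    by auto
  have der: "((\<lambda>h. \<phi> (x + h *\<^sub>R axis j 1)) has_vector_derivative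
      partial_deriv j \<phi> (x + h *\<^sub>R axis j 1)) (at h within A)" for x h A
  proof -
    let ?D = "frechet_derivative \<phi> (at (x + h *\<^sub>R axis j 1))"
    have "(\<phi> has_derivative ?D) (at (x + h *\<^sub>R axis j 1))"
      using smooth_torus_differentiable[OF \<phi>, of "[]"] frechet_derivative_works by auto
    moreover have "((\<lambda>h. x + h *\<^sub>R axis j 1) has_derivative (\<lambda>v. v *\<^sub>R axis j 1)) (at h within A)"
      by (auto intro!: derivative_eq_intros)
    ultimately have "((\<lambda>h. \<phi> (x + h *\<^sub>R axis j 1)) has_derivative (\<lambda>v. ?D (v *\<^sub>R axis j 1)))
        (at h within A)"
      by (rule has_derivative_compose[rotated])
    moreover have "linear ?D"
      using \<open>(\<phi> has_derivative ?D) _\<close> by (rule has_derivative_linear)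
    ultimately show ?thesis
      unfolding has_vector_derivative_def partial_deriv_def by (simp add: linear_scale)
  qed
  have D1: "((\<lambda>h. integral torus_box (\<lambda>x. expi \<xi> x * \<phi> (x + h *\<^sub>R axis j 1))) has_vector_derivative
      integral torus_box (\<lambda>x. expi \<xi> x * partial_deriv j \<phi> (x + 0 *\<^sub>R axis j 1))) (at 0 within {0..1})"
    by (rule leibniz_rule_vector_derivative)
       (auto intro!: integrable_continuous continuous_intros derivative_eq_intros der
          continuous_on_compose2[OF cont(1)[of UNIV]] continuous_on_compose2[OF cont(2)[of UNIV]]
          simp: split_beta)
  have D2: "((\<lambda>h. integral torus_box (\<lambda>x. expi \<xi> x * \<phi> (x + h *\<^sub>R axis j 1)))
      has_vector_derivative - (\<i> * of_int (\<xi> $ j)) * I) (at 0 within {0..1})"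
  proof (rule has_vector_derivative_transform)
    have "((\<lambda>h. exp (- (\<i> * of_int (\<xi> $ j)) * of_real h) * I) has_vector_derivative
        - (\<i> * of_int (\<xi> $ j)) * I) (at 0 within {0..1})"
      by (auto intro!: derivative_eq_intros has_vector_derivative_real_field)
    then show "((\<lambda>h. expi \<xi> (- h *\<^sub>R axis j 1) * I) has_vector_derivative
        - (\<i> * of_int (\<xi> $ j)) * I) (at 0 within {0..1})"
      by (simp add: expi_def inner_axis' mult_ac)
    show "integral torus_box (\<lambda>x. expi \<xi> x * \<phi> (x + h *\<^sub>R axis j 1)) = expi \<xi> (- h *\<^sub>R axis j 1) * I"
      if "h \<in> {0..1}" for h
      unfolding I_def using that pi_gt3 by (intro torus_integral_expi_translate \<phi>) auto
  qed auto
  \<comment> \<open>The translation identity is available for h >= 0, so both derivatives are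
    one-sided at the endpoint of [0,1], where they are still unique.\<close>
  have "integral torus_box (\<lambda>x. expi \<xi> x * partial_deriv j \<phi> x) = - (\<i> * of_int (\<xi> $ j)) * I"
    using vector_derivative_unique_within_closed_interval[OF _ _ D1[folded cbox_interval] D2[folded cbox_interval]]
    by simp
  then show ?thesis
    using \<phi> partial_derivs_in_smooth_torus[OF \<phi>, of "[j]"] by (simp add: distr_of_def I_def)
qed

lemma distr_of_expi_derivs:
  assumes "\<phi> \<in> smooth_torus"
  shows "distr_of (expi \<xi>) (partial_derivs js \<phi>) = (- 1) ^ length js * symbol js \<xi> * distr_of (expi \<xi>) \<phi>"
proof (induction js)
  case (Cons j js)
  then show ?case
    using distr_of_expi_partial_deriv[OF partial_derivs_in_smooth_torus[OF assms, of js]]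
    by (simp add: symbol_def)
qed (simp add: symbol_def)

section \<open>Averages over the torus and orthogonality of exponentials\<close>

lemma content_torus_box: "measure lborel (torus_box :: (real ^ 'n::finite) set) = (2 * pi) ^ CARD('n)"
proof -
  have "(0 :: real ^ 'n) \<in> torus_box" by (simp add: mem_box_cart)
  then have "(torus_box :: (real ^ 'n) set) \<noteq> {}" by blast
  then show ?thesis by (simp add: content_cbox_cart)
qed

text \<open>\<open>distr_of\<close> is normalised by the volume of the box, so it averages the
  product and no constant appears.\<close>

lemma cmod_distr_of_le:
  assumes "\<And>x. cmod (f x * \<phi> x) \<le> B" "continuous_on UNIV f" "\<phi> \<in> smooth_torus"
  shows "cmod (distr_of f \<phi>) \<le> B"
proof -
  have "norm (integral torus_box (\<lambda>x. f x * \<phi> x)) \<le> B * measure lborel (torus_box :: (real ^ 'a) set)"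
    using assms(1)[of 0] smooth_torus_continuous_on[OF assms(3), of _ "[]"]
    by (intro has_integral_bound[OF _ integrable_integral] integrable_continuous continuous_intros
        continuous_on_subset[OF assms(2)]) (auto intro: assms(1) order_trans[OF norm_ge_zero])
  then show ?thesis
    using assms(3) by (simp add: distr_of_def content_torus_box norm_divide norm_power norm_mult divide_le_eq power_mult_distrib)
qed

lemma distr_of_linear:
  assumes "continuous_on UNIV f" "\<phi> \<in> smooth_torus" "\<psi> \<in> smooth_torus"
  shows "distr_of f (\<lambda>x. a * \<phi> x + b * \<psi> x) = a * distr_of f \<phi> + b * distr_of f \<psi>"
proof -
  have int: "(\<lambda>x. f x * \<phi> x) integrable_on torus_box" if "\<phi> \<in> smooth_torus" for \<phi>
    using smooth_torus_continuous_on[OF that, of _ "[]"] continuous_on_subset[OF assms(1)]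
    by (intro integrable_continuous continuous_intros) auto
  have "integral torus_box (\<lambda>x. f x * (a * \<phi> x + b * \<psi> x))
      = integral torus_box (\<lambda>x. a * (f x * \<phi> x) + b * (f x * \<psi> x))"
    by (simp add: algebra_simps)
  also have "\<dots> = a * integral torus_box (\<lambda>x. f x * \<phi> x) + b * integral torus_box (\<lambda>x. f x * \<psi> x)"
    using int[OF assms(2)] int[OF assms(3)]
    by (subst integral_add) (auto intro: integrable_on_mult_right)
  finally show ?thesis
    using assms(2,3) smooth_torus_linear[OF assms(2,3), of a b]
    by (simp add: distr_of_def add_divide_distrib)
qed

text \<open>For different frequencies, choose a coordinate j in which they differ. Evaluating the
  pairing with the j-th derivative of \<open>expi (- \<xi>)\<close> directly and by integration by
  parts gives \<xi>_j I = \<eta>_j I, hence I = 0.\<close>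

lemma distr_of_expi_expi: "distr_of (expi \<eta>) (expi (- \<xi>)) = (if \<eta> = \<xi> then 1 else 0)"
proof -
  define I where "I = distr_of (expi \<eta>) (expi (- \<xi>))"
  show ?thesis
  proof (cases "\<eta> = \<xi>")
    case True
    then show ?thesis
      using expi_in_smooth_torus[of "- \<xi>"] 
      by (simp add: distr_of_def content_torus_box expi_def freq_minus scaleR_conv_of_real flip: exp_add)
  next
    case False
    then obtain j where j: "\<eta> $ j \<noteq> \<xi> $ j" by (auto simp: vec_eq_iff)
    \<comment> \<open>The vanishing second summand gives the derivative the two-term shape of
      \<open>distr_of_linear\<close>.\<close>
    have "partial_deriv j (expi (- \<xi>)) = (\<lambda>x. - (\<i> * of_int (\<xi> $ j)) * expi (- \<xi>) x + 0 * expi (- \<xi>) x)"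
    proof
      fix x
      have "(expi (- \<xi>) has_derivative (\<lambda>v. expi (- \<xi>) x * (- \<i> * of_real (v \<bullet> freq \<xi>)))) (at x)"
      proof -
        have "((\<lambda>x. - (\<i> * of_real (x \<bullet> freq \<xi>))) has_derivative
            (\<lambda>v. - (\<i> * of_real (v \<bullet> freq \<xi>)))) (at x)"
          by (intro has_derivative_minus has_derivative_mult_right has_derivative_of_real
              has_derivative_inner_left has_derivative_ident)
        from has_derivative_compose[OF this DERIV_exp[unfolded has_field_derivative_def]]
        show ?thesis by (simp add: expi_minus[abs_def] mult_ac)
      qed
      from fun_cong[OF frechet_derivative_at[OF this], of "axis j 1", symmetric]
      show "partial_deriv j (expi (- \<xi>)) x = - (\<i> * of_int (\<xi> $ j)) * expi (- \<xi>) x + 0 * expi (- \<xi>) x"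
        by (simp add: partial_deriv_def inner_axis')
    qed
    then have "distr_of (expi \<eta>) (partial_deriv j (expi (- \<xi>))) = - (\<i> * of_int (\<xi> $ j)) * I"
      using distr_of_linear[OF continuous_on_expi[OF continuous_on_id] expi_in_smooth_torus
          expi_in_smooth_torus, of \<eta> "- (\<i> * of_int (\<xi> $ j))" "- \<xi>" 0 "- \<xi>"]
      by (simp only: I_def mult_zero_left add_0_right)
    with distr_of_expi_partial_deriv[OF expi_in_smooth_torus, of \<eta> j "- \<xi>"]
    have "of_int (\<xi> $ j) * I = of_int (\<eta> $ j) * I" by (simp add: I_def)
    with j have "I = 0" by auto
    with False show ?thesis by (simp add: I_def)
  qed
qed

text \<open>Components are integers, so the largest one is either 0, and then \<xi> = 0, or at least
  1 in absolute value. In the second case it also absorbs the summand 1 of the weight.\<close>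

lemma weight_le_max:
  obtains "weight \<xi> \<le> real (1 + CARD('n))"
  | j where "weight \<xi> \<le> real (1 + CARD('n)) * \<bar>real_of_int ((\<xi> :: int ^ 'n::finite) $ j)\<bar>"
proof -
  define m where "m = Max (range (\<lambda>j. \<bar>real_of_int (\<xi> $ j)\<bar>))"
  have "m \<in> range (\<lambda>j. \<bar>real_of_int (\<xi> $ j)\<bar>)" unfolding m_def by (rule Max_in) auto
  then obtain j where j: "m = \<bar>real_of_int (\<xi> $ j)\<bar>" by auto
  have "norm (freq \<xi>) \<le> (\<Sum>j\<in>UNIV. \<bar>freq \<xi> $ j\<bar>)" by (rule norm_le_l1_cart)
  also have "\<dots> \<le> (\<Sum>j\<in>(UNIV :: 'n set). m)" unfolding m_def by (rule sum_mono) simp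
  finally have n: "norm (freq \<xi>) \<le> real CARD('n) * m" by simp
  show thesis
  proof (cases "\<xi> $ j = 0")
    case True
    with j n show thesis by (intro that(1)) auto
  next
    case False
    then have "m \<ge> 1" using j by linarith
    with n have "weight \<xi> \<le> real (1 + CARD('n)) * m" by (simp add: algebra_simps)
    with j show thesis by (intro that(2)) auto
  qed
qed

text \<open>The Frechet seminorm in the continuity condition of
  \<open>distributions\<close>.\<close>

definition seminorm_sum :: "nat \<Rightarrow> (real ^ 'n::finite \<Rightarrow> complex) \<Rightarrow> real" where
  "seminorm_sum k \<phi> = (\<Sum>\<alpha> | mi_order \<alpha> \<le> k. SUP x. cmod (mi_deriv \<alpha> \<phi> x))"

lemma mi_deriv_in_smooth_torus: "\<phi> \<in> smooth_torus \<Longrightarrow> mi_deriv \<alpha> \<phi> \<in> smooth_torus"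
  by (metis mi_deriv_list partial_derivs_in_smooth_torus)

lemma cmod_mi_deriv_le_seminorm_sum:
  assumes "\<phi> \<in> smooth_torus" "mi_order \<alpha> \<le> k"
  shows "cmod (mi_deriv \<alpha> \<phi> x) \<le> seminorm_sum k \<phi>"
proof -
  have "0 \<le> (SUP x. cmod (mi_deriv \<beta> \<phi> x))" for \<beta>
    using order_trans[OF norm_ge_zero cmod_le_SUP_smooth_torus[OF mi_deriv_in_smooth_torus[OF assms(1)]]] .
  then have "(SUP x. cmod (mi_deriv \<alpha> \<phi> x)) \<le> seminorm_sum k \<phi>"
    unfolding seminorm_sum_def using assms(2) by (intro member_le_sum) (auto intro: finite_mi_order_le)
  with cmod_le_SUP_smooth_torus[OF mi_deriv_in_smooth_torus[OF assms(1)]] show ?thesis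
    by (rule order_trans)
qed

text \<open>The largest component of \<open>\<xi>\<close> is comparable to \<open>\<bar>\<xi>\<bar>\<close>, so pure derivatives suffice.\<close>

lemma distr_of_expi_decay:
  fixes \<phi> :: "real ^ 'n::finite \<Rightarrow> complex"
  assumes \<phi>: "\<phi> \<in> smooth_torus"
  shows "weight \<xi> ^ k * cmod (distr_of (expi \<xi>) \<phi>) \<le> real (1 + CARD('n)) ^ k * seminorm_sum k \<phi>"
proof -
  have *: "cmod (distr_of (expi \<xi>) (mi_deriv \<alpha> \<phi>)) \<le> seminorm_sum k \<phi>" if "mi_order \<alpha> \<le> k" for \<alpha>
    by (rule cmod_distr_of_le)
       (auto simp: norm_mult intro!: cmod_mi_deriv_le_seminorm_sum \<phi> that continuous_intros
          mi_deriv_in_smooth_torus)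
  show ?thesis
  proof (rule weight_le_max[of \<xi>])
    assume "weight \<xi> \<le> real (1 + CARD('n))"
    moreover have "cmod (distr_of (expi \<xi>) \<phi>) \<le> seminorm_sum k \<phi>"
      using *[of "\<lambda>_. 0"] by (simp add: mi_deriv_zero mi_order_def)
    ultimately show ?thesis
      by (intro mult_mono power_mono) (auto intro: order_trans[OF norm_ge_zero])
  next
    fix j assume j: "weight \<xi> \<le> real (1 + CARD('n)) * \<bar>real_of_int (\<xi> $ j)\<bar>"
    let ?\<alpha> = "\<lambda>i. if i = j then k else 0"
    have "symbol (replicate n j) \<xi> = (\<i> * of_int (\<xi> $ j)) ^ n" for n
      by (induction n) (auto simp: symbol_def)
    then have "cmod (distr_of (expi \<xi>) (mi_deriv ?\<alpha> \<phi>))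
        = \<bar>real_of_int (\<xi> $ j)\<bar> ^ k * cmod (distr_of (expi \<xi>) \<phi>)"
      unfolding mi_deriv_single distr_of_expi_derivs[OF \<phi>]
      by (simp add: norm_mult norm_power)
    then have k: "\<bar>real_of_int (\<xi> $ j)\<bar> ^ k * cmod (distr_of (expi \<xi>) \<phi>) \<le> seminorm_sum k \<phi>"
      using *[of ?\<alpha>] by (simp add: mi_order_def)
    have "weight \<xi> ^ k * cmod (distr_of (expi \<xi>) \<phi>)
        \<le> (real (1 + CARD('n)) * \<bar>real_of_int (\<xi> $ j)\<bar>) ^ k * cmod (distr_of (expi \<xi>) \<phi>)"
      using j by (intro mult_right_mono power_mono) auto
    also have "\<dots> \<le> real (1 + CARD('n)) ^ k * seminorm_sum k \<phi>"
      using k by (simp only: power_mult_distrib mult.assoc mult_left_mono zero_le_power of_nat_0_le_iff)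
    finally show ?thesis .
  qed
qed

section \<open>Distributions with polynomially bounded coefficients\<close>

definition distr_series :: "(int ^ 'n \<Rightarrow> complex) \<Rightarrow> ('n::finite) functional" where
  "distr_series c = (\<lambda>\<phi>\<in>smooth_torus. \<Sum>\<^sub>\<infinity>\<xi>. c \<xi> * distr_of (expi \<xi>) \<phi>)"

context
  fixes c :: "int ^ 'n::finite \<Rightarrow> complex" and K :: real and m :: nat
  assumes poly_bound: "\<And>\<xi>. cmod (c \<xi>) \<le> K * weight \<xi> ^ m"
begin

text \<open>Number of derivatives taken from the test function: m to cancel the growth of the
  coefficients and 2N to leave a factor summable by \<open>summable_weight\<close>.\<close>

definition "order_bound = m + 2 * CARD('n)"

lemma distr_series_term_le:
  assumes "\<phi> \<in> smooth_torus"
  shows "cmod (c \<xi> * distr_of (expi \<xi>) \<phi>)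
    \<le> K * real (1 + CARD('n)) ^ order_bound * seminorm_sum order_bound \<phi> * (1 / weight \<xi> ^ (2 * CARD('n)))"
proof -
  \<comment> \<open>Evaluating \<open>poly_bound\<close> at \<xi> = 0 forces the sign of
    \<open>K\<close>.\<close>
  have K: "K \<ge> 0"
    using order_trans[OF norm_ge_zero poly_bound[of 0]] zero_less_power[OF weight_pos, of 0 m]
      mult_neg_pos[of K] by (meson not_less)
  let ?w = "weight \<xi>" and ?M = "2 * CARD('n)"
  have "cmod (c \<xi> * distr_of (expi \<xi>) \<phi>) * ?w ^ ?M
      \<le> K * ?w ^ m * cmod (distr_of (expi \<xi>) \<phi>) * ?w ^ ?M"
    unfolding norm_mult by (intro mult_right_mono poly_bound) auto
  also have "\<dots> = K * (?w ^ order_bound * cmod (distr_of (expi \<xi>) \<phi>))"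
    by (simp add: order_bound_def power_add mult_ac)
  also have "\<dots> \<le> K * (real (1 + CARD('n)) ^ order_bound * seminorm_sum order_bound \<phi>)"
    by (intro mult_left_mono distr_of_expi_decay assms K)
  finally show ?thesis
    by (simp add: pos_le_divide_eq mult.assoc)
qed

lemma distr_series_has_sum:
  assumes "\<phi> \<in> smooth_torus"
  shows "((\<lambda>\<xi>. c \<xi> * distr_of (expi \<xi>) \<phi>) has_sum distr_series c \<phi>) UNIV"
proof -
  have "(\<lambda>\<xi>. norm (c \<xi> * distr_of (expi \<xi>) \<phi>)) summable_on UNIV"
    using summable_on_cmult_right[OF summable_weight[where 'n = 'n, OF order_refl]] distr_series_term_le[OF assms]
    by (rule Infinite_Sum.abs_summable_on_comparison_test')
  then show ?thesis
    using assms abs_summable_summable by (fastforce simp: distr_series_def)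
qed

lemma distr_series_in_distributions: "distr_series c \<in> distributions"
  unfolding distributions_def
proof (intro CollectI conjI ballI allI)
  show "distr_series c \<in> extensional smooth_torus" by (simp add: distr_series_def)
  fix \<phi> \<psi> :: "real ^ 'n \<Rightarrow> complex" and a b
  assume \<phi>: "\<phi> \<in> smooth_torus" and \<psi>: "\<psi> \<in> smooth_torus"
  have "((\<lambda>\<xi>. a * (c \<xi> * distr_of (expi \<xi>) \<phi>) + b * (c \<xi> * distr_of (expi \<xi>) \<psi>))
      has_sum (a * distr_series c \<phi> + b * distr_series c \<psi>)) UNIV"
    by (intro has_sum_add has_sum_cmult_right distr_series_has_sum \<phi> \<psi>)
  then have "((\<lambda>\<xi>. c \<xi> * distr_of (expi \<xi>) (\<lambda>x. a * \<phi> x + b * \<psi> x))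
      has_sum (a * distr_series c \<phi> + b * distr_series c \<psi>)) UNIV"
    by (simp add: distr_of_linear[OF continuous_on_expi[OF continuous_on_id] \<phi> \<psi>] algebra_simps)
  with distr_series_has_sum[OF smooth_torus_linear[OF \<phi> \<psi>]]
  show "distr_series c (\<lambda>x. a * \<phi> x + b * \<psi> x) = a * distr_series c \<phi> + b * distr_series c \<psi>"
    using has_sum_unique by blast
next
  define B where "B = (\<Sum>\<^sub>\<infinity>\<xi>::int ^ 'n. 1 / weight \<xi> ^ (2 * CARD('n)))"
  have "cmod (distr_series c \<phi>) \<le> K * real (1 + CARD('n)) ^ order_bound * B * seminorm_sum order_bound \<phi>"
    if "\<phi> \<in> smooth_torus" for \<phi>
  proof -
    have "((\<lambda>\<xi>. K * real (1 + CARD('n)) ^ order_bound * seminorm_sum order_bound \<phi> * (1 / weight \<xi> ^ (2 * CARD('n))))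
        has_sum (K * real (1 + CARD('n)) ^ order_bound * seminorm_sum order_bound \<phi> * B)) (UNIV :: (int ^ 'n) set)"
      unfolding B_def by (intro has_sum_cmult_right has_sum_infsum summable_weight) simp
    from norm_infsum_le[OF distr_series_has_sum[OF that] this distr_series_term_le[OF that]]
    show ?thesis by (simp add: mult_ac)
  qed
  then show "\<exists>C k. \<forall>\<phi>\<in>smooth_torus. cmod (distr_series c \<phi>)
      \<le> C * (\<Sum>\<alpha> | mi_order \<alpha> \<le> k. SUP x. cmod (mi_deriv \<alpha> \<phi> x))"
    unfolding seminorm_sum_def[symmetric] by blast
qed

lemma distr_sums_distr_series: "distr_sums c (distr_series c)"
  unfolding distr_sums_def using distr_series_in_distributions distr_series_has_sum by blast

text \<open>Testing against \<open>expi (- \<xi>)\<close> leaves one term of the series by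
  orthogonality.\<close>

lemma fourier_distr_series: "fourier (distr_series c) = c"
proof
  fix \<xi>
  have "((\<lambda>\<eta>. c \<eta> * distr_of (expi \<eta>) (expi (- \<xi>))) has_sum fourier (distr_series c) \<xi>) UNIV"
    unfolding fourier_eq by (intro distr_series_has_sum expi_in_smooth_torus)
  moreover have "((\<lambda>\<eta>. c \<eta> * distr_of (expi \<eta>) (expi (- \<xi>))) has_sum (\<Sum>\<eta>\<in>{\<xi>}. c \<eta>)) UNIV"
    by (rule has_sum_cong_neutral[THEN iffD1, OF _ _ _ has_sum_finite[of "{\<xi>}"]])
       (auto simp: distr_of_expi_expi)
  ultimately show "fourier (distr_series c) \<xi> = c \<xi>" using has_sum_unique by fastforce
qed

end

section \<open>Continuity of the coefficients of the formal solution\<close>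

lemma continuous_on_primitive:
  "continuous_on {0..T} a \<Longrightarrow> continuous_on {0..T} (primitive a)"
  unfolding primitive_def[abs_def]
  by (intro indefinite_integral_continuous_1 integrable_continuous_real)

text \<open>The exponent in the integral is a difference of one phase \<open>P\<close> at s and t.
  Its t-dependent factor can be pulled out of the integral, and what remains is an indefinite
  integral of a fixed continuous function.\<close>

lemma continuous_on_u_hat:
  assumes "continuous_on {0..T} a\<^sub>2" "\<And>j. continuous_on {0..T} (a\<^sub>1 j)" "continuous_on {0..T} a\<^sub>0"
    and f: "continuous_on {0..T} (\<lambda>s. f_hat s \<xi>)"
  shows "continuous_on {0..T} (\<lambda>t. u_hat a\<^sub>2 a\<^sub>1 a\<^sub>0 f_hat g_hat t \<xi>)"
proof -
  define P where "P t = primitive a\<^sub>2 t * (norm (freq \<xi>))\<^sup>2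
      + (\<Sum>j\<in>UNIV. primitive (a\<^sub>1 j) t * of_int (\<xi> $ j)) + primitive a\<^sub>0 t" for t
  have P: "continuous_on {0..T} P"
    unfolding P_def[abs_def]
    by (intro continuous_intros continuous_on_primitive assms)
  have "exp (\<i> * ((primitive a\<^sub>2 s - primitive a\<^sub>2 t) * (norm (freq \<xi>))\<^sup>2
        + (\<Sum>j\<in>UNIV. (primitive (a\<^sub>1 j) s - primitive (a\<^sub>1 j) t) * of_int (\<xi> $ j))
        + (primitive a\<^sub>0 s - primitive a\<^sub>0 t))) = exp (- \<i> * P t) * exp (\<i> * P s)" for s t
    unfolding P_def by (simp add: algebra_simps sum_subtractf flip: exp_add)
  then have "u_hat a\<^sub>2 a\<^sub>1 a\<^sub>0 f_hat g_hat t \<xi> = g_hat \<xi> * exp (- \<i> * P t)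
      + \<i> * integral {0..t} (\<lambda>s. exp (- \<i> * P t) * (f_hat s \<xi> * exp (\<i> * P s)))" for t
    unfolding u_hat_def Let_def P_def[symmetric] by (simp only: mult.left_commute)
  then have "u_hat a\<^sub>2 a\<^sub>1 a\<^sub>0 f_hat g_hat t \<xi> = g_hat \<xi> * exp (- \<i> * P t)
      + \<i> * (exp (- \<i> * P t) * integral {0..t} (\<lambda>s. f_hat s \<xi> * exp (\<i> * P s)))" for t
    by (simp only: integral_mult_right)
  then show ?thesis
    by (simp only:)
       (intro continuous_intros indefinite_integral_continuous_1 integrable_continuous_real f P)
qed

section \<open>Continuous curves in a topological space\<close>

lemma C_intervalI:
  assumes "\<And>t. t \<in> {0..T} \<Longrightarrow> u t \<in> topspace X"
    and "\<And>V t. openin X V \<Longrightarrow> t \<in> {0..T} \<Longrightarrow> u t \<in> V \<Longrightarrow> \<forall>\<^sub>F t' in at t within {0..T}. u t' \<in> V"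
  shows "u \<in> C_interval T X"
  unfolding C_interval_def continuous_map_def
proof (intro CollectI conjI allI impI)
  fix V assume V: "openin X V"
  show "openin (top_of_set {0..T}) {t \<in> topspace (top_of_set {0..T}). u t \<in> V}"
    unfolding openin_euclidean_subtopology_iff
  proof (intro conjI ballI)
    fix t assume "t \<in> {t \<in> topspace (top_of_set {0..T}). u t \<in> V}"
    then have t: "t \<in> {0..T}" "u t \<in> V" by auto
    with assms(2)[OF V] obtain d where "d > 0"
        "\<forall>t'\<in>{0..T}. t' \<noteq> t \<and> dist t' t < d \<longrightarrow> u t' \<in> V"
      unfolding eventually_at by blast
    \<comment> \<open>The punctured neighbourhood leaves out t itself, where membership is the
      assumption on \<open>u t\<close>.\<close>
    with t show "\<exists>e>0. \<forall>t'\<in>{0..T}. dist t' t < e \<longrightarrow>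
        t' \<in> {t \<in> topspace (top_of_set {0..T}). u t \<in> V}"
      by (intro exI[of _ d]) force
  qed auto
qed (use assms(1) in auto)

lemma C_interval_topspace: "u \<in> C_interval T X \<Longrightarrow> t \<in> {0..T} \<Longrightarrow> u t \<in> topspace X"
  by (auto simp: C_interval_def continuous_map_def)

lemma C_interval_continuous_on:
  assumes "f \<in> C_interval T X" "continuous_map X euclidean F"
  shows "continuous_on {0..T} (\<lambda>t. F (f t))"
  using continuous_map_compose[of "top_of_set {0..T}" X f euclidean F] assms
  by (auto simp: C_interval_def o_def)

section \<open>Sobolev spaces\<close>

text \<open>The Minkowski inequality on finite sets bounds every finite sum of squares by one
  constant. This yields summability and, in the supremum, the inequality for the infinite
  sums.\<close>

lemma l2_triangle:
  fixes f g h :: "'a \<Rightarrow> real"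
  assumes f: "(\<lambda>x. (f x)\<^sup>2) summable_on UNIV" and g: "(\<lambda>x. (g x)\<^sup>2) summable_on UNIV"
    and h: "\<And>x. \<bar>h x\<bar> \<le> \<bar>f x\<bar> + \<bar>g x\<bar>"
  shows "(\<lambda>x. (h x)\<^sup>2) summable_on UNIV"
    and "sqrt (\<Sum>\<^sub>\<infinity>x. (h x)\<^sup>2) \<le> sqrt (\<Sum>\<^sub>\<infinity>x. (f x)\<^sup>2) + sqrt (\<Sum>\<^sub>\<infinity>x. (g x)\<^sup>2)"
proof -
  let ?N = "sqrt (\<Sum>\<^sub>\<infinity>x. (f x)\<^sup>2) + sqrt (\<Sum>\<^sub>\<infinity>x. (g x)\<^sup>2)"
  have fin: "(\<Sum>x\<in>F. (h x)\<^sup>2) \<le> ?N\<^sup>2" if "finite F" for F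
  proof -
    have "L2_set h F \<le> L2_set (\<lambda>x. \<bar>f x\<bar> + \<bar>g x\<bar>) F"
      using L2_set_mono[of F "\<lambda>x. \<bar>h x\<bar>"] h by (simp add: L2_set_def)
    also have "\<dots> \<le> L2_set f F + L2_set g F"
      using L2_set_triangle_ineq[of "\<lambda>x. \<bar>f x\<bar>" "\<lambda>x. \<bar>g x\<bar>" F] by (simp add: L2_set_def)
    also have "\<dots> \<le> ?N"
      unfolding L2_set_def using f g that
      by (intro add_mono real_sqrt_le_mono finite_sum_le_infsum) auto
    finally have "L2_set h F ^ 2 \<le> ?N\<^sup>2" by (intro power_mono) auto
    then show ?thesis by (simp add: L2_set_def sum_nonneg)
  qed
  show s: "(\<lambda>x. (h x)\<^sup>2) summable_on UNIV"
    by (rule nonneg_bdd_above_summable_on) (auto intro!: bdd_aboveI2 fin)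
  have "(\<Sum>\<^sub>\<infinity>x. (h x)\<^sup>2) \<le> ?N\<^sup>2"
    by (rule infsum_le_finite_sums[OF s fin])
  then show "sqrt (\<Sum>\<^sub>\<infinity>x. (h x)\<^sup>2) \<le> ?N"
    by (intro real_le_lsqrt add_nonneg_nonneg real_sqrt_ge_zero infsum_nonneg) auto
qed

section \<open>The Sobolev norm as a weighted l2 norm of coefficients\<close>

lemma fourier_diff_restrict:
  "fourier (\<lambda>\<phi>\<in>smooth_torus. w \<phi> - v \<phi>) \<xi> = fourier w \<xi> - fourier v \<xi>"
  by (simp add: fourier_eq expi_in_smooth_torus)

lemma sq_mult_weight: "x\<^sup>2 * weight \<xi> powr (2 * r) = (x * weight \<xi> powr r)\<^sup>2"
  by (simp add: power_mult_distrib power2_eq_square flip: powr_add)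

lemma sobolev_summable:
  "u \<in> sobolev r \<Longrightarrow> (\<lambda>\<xi>. (cmod (fourier u \<xi>) * weight \<xi> powr r)\<^sup>2) summable_on UNIV"
  by (simp add: sobolev_def sq_mult_weight)

lemma sobolev_norm_eq: "sobolev_norm r u = sqrt (\<Sum>\<^sub>\<infinity>\<xi>. (cmod (fourier u \<xi>) * weight \<xi> powr r)\<^sup>2)"
  by (simp add: sobolev_norm_def sq_mult_weight)

lemma sobolev_norm_diff_eq:
  "sobolev_norm r (\<lambda>\<phi>\<in>smooth_torus. w \<phi> - v \<phi>)
    = sqrt (\<Sum>\<^sub>\<infinity>\<xi>. (cmod (fourier w \<xi> - fourier v \<xi>) * weight \<xi> powr r)\<^sup>2)"
  by (simp add: sobolev_norm_eq fourier_diff_restrict)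

lemma sobolev_diff_summable:
  assumes "v \<in> sobolev r" "w \<in> sobolev r"
  shows "(\<lambda>\<xi>. (cmod (fourier w \<xi> - fourier v \<xi>) * weight \<xi> powr r)\<^sup>2) summable_on UNIV"
  using sobolev_summable[OF assms(2)] sobolev_summable[OF assms(1)]
  by (rule l2_triangle) (auto simp: abs_mult norm_triangle_ineq4 intro!: mult_right_mono simp flip: distrib_right)

text \<open>Used in both orders of \<open>v\<close> and \<open>w\<close>, this shows that the norm
  is Lipschitz with constant 1 for its own distance.\<close>

lemma sobolev_norm_le_add_diff:
  assumes "v \<in> sobolev r" "w \<in> sobolev r"
  shows "sobolev_norm r w \<le> sobolev_norm r (\<lambda>\<phi>\<in>smooth_torus. w \<phi> - v \<phi>) + sobolev_norm r v"
  unfolding sobolev_norm_diff_eq sobolev_norm_eq[of r w] sobolev_norm_eq[of r v]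
proof (rule l2_triangle(2)[OF sobolev_diff_summable[OF assms] sobolev_summable[OF assms(1)]])
  fix \<xi>
  have "cmod (fourier w \<xi>) \<le> cmod (fourier w \<xi> - fourier v \<xi>) + cmod (fourier v \<xi>)"
    using norm_triangle_ineq[of "fourier w \<xi> - fourier v \<xi>" "fourier v \<xi>"] by simp
  then show "\<bar>cmod (fourier w \<xi>) * weight \<xi> powr r\<bar>
      \<le> \<bar>cmod (fourier w \<xi> - fourier v \<xi>) * weight \<xi> powr r\<bar> + \<bar>cmod (fourier v \<xi>) * weight \<xi> powr r\<bar>"
    by (simp add: abs_mult mult_right_mono flip: distrib_right)
qed

lemma sobolev_norm_diff_commute:
  "sobolev_norm r (\<lambda>\<phi>\<in>smooth_torus. w \<phi> - v \<phi>) = sobolev_norm r (\<lambda>\<phi>\<in>smooth_torus. v \<phi> - w \<phi>)"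
  unfolding sobolev_norm_diff_eq by (simp add: norm_minus_commute)

lemma cmod_fourier_diff_le:
  assumes "v \<in> sobolev r" "w \<in> sobolev r"
  shows "cmod (fourier w \<xi> - fourier v \<xi>)
    \<le> weight \<xi> powr (- r) * sobolev_norm r (\<lambda>\<phi>\<in>smooth_torus. w \<phi> - v \<phi>)"
proof -
  have "(cmod (fourier w \<xi> - fourier v \<xi>) * weight \<xi> powr r)\<^sup>2
      \<le> (\<Sum>\<^sub>\<infinity>\<xi>. (cmod (fourier w \<xi> - fourier v \<xi>) * weight \<xi> powr r)\<^sup>2)"
    using finite_sum_le_infsum[OF sobolev_diff_summable[OF assms], of "{\<xi>}"] by simp
  then have "cmod (fourier w \<xi> - fourier v \<xi>) * weight \<xi> powr r
      \<le> sobolev_norm r (\<lambda>\<phi>\<in>smooth_torus. w \<phi> - v \<phi>)"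
    unfolding sobolev_norm_diff_eq by (rule real_le_rsqrt)
  then have "weight \<xi> powr (- r) * (cmod (fourier w \<xi> - fourier v \<xi>) * weight \<xi> powr r)
      \<le> weight \<xi> powr (- r) * sobolev_norm r (\<lambda>\<phi>\<in>smooth_torus. w \<phi> - v \<phi>)"
    by (rule mult_left_mono) simp
  moreover have "weight \<xi> powr (- r) * (cmod (fourier w \<xi> - fourier v \<xi>) * weight \<xi> powr r)
      = cmod (fourier w \<xi> - fourier v \<xi>)"
    by (simp add: powr_minus)
  ultimately show ?thesis by simp
qed

text \<open>A Lipschitz criterion for the topology given by \<open>sobolev_open\<close>. It serves
  the Fourier coefficients, with constant (1+|\<xi>|)^(-r), and the norm itself, with constant
  1.\<close>

lemma continuous_map_sobolev:
  fixes F :: "('n::finite) functional \<Rightarrow> 'b::metric_space"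
  assumes K: "K > 0" and F: "\<And>v w. v \<in> sobolev r \<Longrightarrow> w \<in> sobolev r \<Longrightarrow>
      dist (F w) (F v) \<le> K * sobolev_norm r (\<lambda>\<phi>\<in>smooth_torus. w \<phi> - v \<phi>)"
  shows "continuous_map (sobolev_topology r) euclidean F"
  unfolding continuous_map_def
proof (intro conjI allI impI)
  fix U :: "'b set" assume "openin euclidean U"
  then have U: "open U" by simp
  show "openin (sobolev_topology r) {w \<in> topspace (sobolev_topology r). F w \<in> U}"
    unfolding openin_sobolev_topology topspace_sobolev_topology sobolev_open_def
  proof (intro conjI ballI)
    fix v assume "v \<in> {w \<in> sobolev r. F w \<in> U}"
    then have v: "v \<in> sobolev r" "F v \<in> U" by auto
    with U obtain e where e: "e > 0" "\<And>y. dist y (F v) < e \<Longrightarrow> y \<in> U"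
      unfolding open_dist by blast
    show "\<exists>\<epsilon>>0. \<forall>w\<in>sobolev r. sobolev_norm r (\<lambda>\<phi>\<in>smooth_torus. w \<phi> - v \<phi>) < \<epsilon>
        \<longrightarrow> w \<in> {w \<in> sobolev r. F w \<in> U}"
    proof (intro exI[of _ "e / K"] conjI ballI impI)
      fix w assume w: "w \<in> sobolev r" "sobolev_norm r (\<lambda>\<phi>\<in>smooth_torus. w \<phi> - v \<phi>) < e / K"
      then have "dist (F w) (F v) < e"
        using F[OF v(1) w(1)] K by (simp add: field_simps)
      with e w show "w \<in> {w \<in> sobolev r. F w \<in> U}" by auto
    qed (use e K in auto)
  qed auto
qed auto

section \<open>Continuous curves in Sobolev spaces\<close>

lemma C_interval_sobolev_fourier:
  assumes "f \<in> C_interval T (sobolev_topology r)"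
  shows "continuous_on {0..T} (\<lambda>t. fourier (f t) \<xi>)"
proof (rule C_interval_continuous_on[OF assms continuous_map_sobolev])
  show "weight \<xi> powr (- r) > 0" by simp
qed (auto simp: dist_norm intro: cmod_fourier_diff_le)

lemma C_interval_sobolev_bounded:
  assumes "f \<in> C_interval T (sobolev_topology r)"
  obtains M where "\<And>t. t \<in> {0..T} \<Longrightarrow> sobolev_norm r (f t) \<le> M"
proof -
  have "continuous_on {0..T} (\<lambda>t. sobolev_norm r (f t))"
  proof (rule C_interval_continuous_on[OF assms continuous_map_sobolev[of 1]])
    show "dist (sobolev_norm r w) (sobolev_norm r v)
        \<le> 1 * sobolev_norm r (\<lambda>\<phi>\<in>smooth_torus. w \<phi> - v \<phi>)"
      if "v \<in> sobolev r" "w \<in> sobolev r" for v w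
      using sobolev_norm_le_add_diff[OF that] sobolev_norm_le_add_diff[OF that(2,1)]
        sobolev_norm_diff_commute[of r v w]
      by (simp add: dist_real_def)
  qed simp
  then have "bdd_above ((\<lambda>t. sobolev_norm r (f t)) ` {0..T})"
    by (intro bounded_imp_bdd_above compact_imp_bounded compact_continuous_image) auto
  then obtain M where "\<forall>t\<in>{0..T}. sobolev_norm r (f t) \<le> M" unfolding bdd_above_def by auto
  then show thesis using that[of M] by blast
qed

text \<open>For finitely many frequencies the sum and the time integral commute, and the integrand
  is at most the squared norm of f(s). Hence every finite partial sum is at most T M^2.\<close>

lemma sobolev_time_integral_summable:
  assumes f: "f \<in> C_interval T (sobolev_topology r)" and T: "T > 0"
  shows "(\<lambda>\<xi>. integral {0..T} (\<lambda>s. (cmod (fourier (f s) \<xi>))\<^sup>2) * weight \<xi> powr (2 * r)) summable_on UNIV"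
proof -
  obtain M where M: "\<And>t. t \<in> {0..T} \<Longrightarrow> sobolev_norm r (f t) \<le> M"
    using C_interval_sobolev_bounded[OF f] by blast
  let ?g = "\<lambda>\<xi> s. (cmod (fourier (f s) \<xi>))\<^sup>2 * weight \<xi> powr (2 * r)"
  have int: "?g \<xi> integrable_on {0..T}" for \<xi>
    by (intro integrable_continuous_real continuous_intros C_interval_sobolev_fourier[OF f])
  have "(\<Sum>\<xi>\<in>F. integral {0..T} (?g \<xi>)) \<le> T * M\<^sup>2" if F: "finite F" for F
  proof -
    have "(\<Sum>\<xi>\<in>F. integral {0..T} (?g \<xi>)) = integral {0..T} (\<lambda>s. \<Sum>\<xi>\<in>F. ?g \<xi> s)"
      using F int by (simp add: integral_sum)
    also have "\<dots> \<le> integral {0..T} (\<lambda>s. M\<^sup>2)"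
    proof (rule integral_le)
      fix s assume s: "s \<in> {0..T}"
      then have "f s \<in> sobolev r"
        using C_interval_topspace[OF f] by (simp add: topspace_sobolev_topology)
      then have "(\<Sum>\<xi>\<in>F. ?g \<xi> s) \<le> (\<Sum>\<^sub>\<infinity>\<xi>. ?g \<xi> s)"
        using F by (intro finite_sum_le_infsum) (auto simp: sobolev_def)
      also have "\<dots> = (sobolev_norm r (f s))\<^sup>2"
        unfolding sobolev_norm_def by (simp add: infsum_nonneg)
      also have "\<dots> \<le> M\<^sup>2"
        using M[OF s] by (intro power_mono) (auto simp: sobolev_norm_def infsum_nonneg)
      finally show "(\<Sum>\<xi>\<in>F. ?g \<xi> s) \<le> M\<^sup>2" .
    qed (use F int in \<open>auto intro!: integrable_sum\<close>)
    finally show ?thesis using T by simp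
  qed
  then show ?thesis
    by (intro nonneg_bdd_above_summable_on bdd_aboveI2)
       (auto intro!: mult_nonneg_nonneg integral_nonneg integrable_continuous_real continuous_intros
          C_interval_sobolev_fourier[OF f])
qed

lemma C_interval_sobolevI:
  assumes u: "\<And>t. t \<in> {0..T} \<Longrightarrow> u t \<in> sobolev \<sigma>"
    and lim: "\<And>t0. t0 \<in> {0..T} \<Longrightarrow>
      ((\<lambda>t. sobolev_norm \<sigma> (\<lambda>\<phi>\<in>smooth_torus. u t \<phi> - u t0 \<phi>)) \<longlongrightarrow> 0) (at t0 within {0..T})"
  shows "u \<in> C_interval T (sobolev_topology \<sigma>)"
proof (rule C_intervalI)
  fix V t assume "openin (sobolev_topology \<sigma>) V" and t: "t \<in> {0..T}" "u t \<in> V"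
  then obtain e where e: "e > 0" "\<And>w. w \<in> sobolev \<sigma> \<Longrightarrow>
      sobolev_norm \<sigma> (\<lambda>\<phi>\<in>smooth_torus. w \<phi> - u t \<phi>) < e \<Longrightarrow> w \<in> V"
    unfolding openin_sobolev_topology sobolev_open_def by meson
  have "\<forall>\<^sub>F t' in at t within {0..T}. t' \<in> {0..T}"
    by (auto simp: eventually_at intro: exI[of _ 1])
  then show "\<forall>\<^sub>F t' in at t within {0..T}. u t' \<in> V"
    using order_tendstoD(2)[OF lim[OF t(1)] e(1)]
    by eventually_elim (rule e(2)[OF u])
qed (simp add: topspace_sobolev_topology u)

text \<open>Everything rests on one square summable majorant \<open>G\<close>, independent of t, of
  the coefficients weighted by (1+|\<xi>|)^(r-\<rho>). It gives the distribution, its membership for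
  each order up to r-\<rho>, and the domination needed for continuity.\<close>

lemma sobolev_solution:
  fixes f :: "real \<Rightarrow> ('n::finite) functional"
  assumes T: "T > 0" and a: "continuous_on {0..T} a\<^sub>2" "\<And>j. continuous_on {0..T} (a\<^sub>1 j)" "continuous_on {0..T} a\<^sub>0"
    and f: "f \<in> C_interval T (sobolev_topology r)" and g: "g \<in> sobolev r"
    and bound: "\<And>t \<xi>. t \<in> {0..T} \<Longrightarrow> cmod (u_hat a\<^sub>2 a\<^sub>1 a\<^sub>0 (\<lambda>s. fourier (f s)) (fourier g) t \<xi>)
        \<le> C * weight \<xi> powr \<rho> *
          (cmod (fourier g \<xi>) + sqrt (integral {0..T} (\<lambda>s. (cmod (fourier (f s) \<xi>))\<^sup>2)))"
  shows "\<exists>u. (\<forall>t\<in>{0..T}. distr_sums (u_hat a\<^sub>2 a\<^sub>1 a\<^sub>0 (\<lambda>s. fourier (f s)) (fourier g) t) (u t) \<and>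
              u t \<in> sobolev (r - \<rho>)) \<and> u \<in> C_interval T (sobolev_topology (r - 2 - \<rho>))"
proof -
  let ?u = "u_hat a\<^sub>2 a\<^sub>1 a\<^sub>0 (\<lambda>s. fourier (f s)) (fourier g)"
  define I where "I \<xi> = integral {0..T} (\<lambda>s. (cmod (fourier (f s) \<xi>))\<^sup>2)" for \<xi>
  define G where "G \<xi> = (cmod (fourier g \<xi>) + sqrt (I \<xi>)) * weight \<xi> powr r" for \<xi>
  have I: "I \<xi> \<ge> 0" for \<xi>
    unfolding I_def
    by (intro integral_nonneg integrable_continuous_real continuous_intros C_interval_sobolev_fourier[OF f]) auto
  have G0: "G \<xi> \<ge> 0" for \<xi> using I by (simp add: G_def)
  have "(\<lambda>\<xi>. (sqrt (I \<xi>) * weight \<xi> powr r)\<^sup>2) summable_on UNIV"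
    using sobolev_time_integral_summable[OF f T] I
    by (simp add: I_def[symmetric] flip: sq_mult_weight)
  from l2_triangle(1)[OF sobolev_summable[OF g] this, of G]
  have G: "(\<lambda>\<xi>. (G \<xi>)\<^sup>2) summable_on UNIV"
    using I by (simp add: G_def abs_mult distrib_right)
  \<comment> \<open>A single term is bounded by the whole sum, so \<open>S\<close> bounds
    \<open>G\<close> uniformly. This turns the l2 majorant into polynomial growth.\<close>
  define S where "S = sqrt (\<Sum>\<^sub>\<infinity>\<xi>. (G \<xi>)\<^sup>2)"
  have GS: "G \<xi> \<le> S" for \<xi>
    unfolding S_def using finite_sum_le_infsum[OF G, of "{\<xi>}"] by (intro real_le_rsqrt) simp
  \<comment> \<open>A nonnegative constant, so that it can be multiplied through
    inequalities.\<close>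
  define D where "D = \<bar>C\<bar>"
  have bound': "cmod (?u t \<xi>) * weight \<xi> powr (r - \<rho>) \<le> D * G \<xi>" if "t \<in> {0..T}" for t \<xi>
  proof -
    have "cmod (?u t \<xi>) * weight \<xi> powr (r - \<rho>)
        \<le> C * weight \<xi> powr \<rho> * (cmod (fourier g \<xi>) + sqrt (I \<xi>)) * weight \<xi> powr (r - \<rho>)"
      unfolding I_def by (intro mult_right_mono bound that) auto
    also have "\<dots> = C * G \<xi>"
      by (simp add: G_def mult_ac flip: powr_add)
    also have "\<dots> \<le> D * G \<xi>"
      unfolding D_def by (intro mult_right_mono G0) auto
    finally show ?thesis .
  qed
  \<comment> \<open>The polynomial bound asks for a natural exponent. Rounding up, and truncating at
    0, only enlarges the power since the weight is at least 1.\<close>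
  define m where "m = nat \<lceil>\<rho> - r\<rceil>"
  have poly: "cmod (?u t \<xi>) \<le> (D * S) * weight \<xi> ^ m" if "t \<in> {0..T}" for t \<xi>
  proof -
    have "cmod (?u t \<xi>) = cmod (?u t \<xi>) * weight \<xi> powr (r - \<rho>) * weight \<xi> powr (\<rho> - r)"
      by (simp add: mult.assoc flip: powr_add)
    also have "\<dots> \<le> (D * G \<xi>) * weight \<xi> powr (\<rho> - r)"
      by (intro mult_right_mono bound' that) auto
    also have "\<dots> \<le> (D * S) * weight \<xi> ^ m"
    proof (intro mult_mono)
      have "weight \<xi> powr (\<rho> - r) \<le> weight \<xi> powr real m"
        unfolding m_def by (intro powr_mono) (auto simp: real_nat_ceiling_ge)
      then show "weight \<xi> powr (\<rho> - r) \<le> weight \<xi> ^ m" by (simp add: powr_realpow)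
    qed (use GS G0 in \<open>auto simp: D_def S_def intro!: mult_nonneg_nonneg infsum_nonneg\<close>)
    finally show ?thesis .
  qed
  define u where "u t = distr_series (?u t)" for t
  have four: "fourier (u t) = ?u t" if "t \<in> {0..T}" for t
    unfolding u_def using fourier_distr_series[OF poly[OF that]] .
  have sum: "distr_sums (?u t) (u t)" if "t \<in> {0..T}" for t
    unfolding u_def using distr_sums_distr_series[OF poly[OF that]] .
  have DG: "(\<lambda>\<xi>. (K * G \<xi>)\<^sup>2) summable_on UNIV" for K
    unfolding power_mult_distrib by (intro summable_on_cmult_right G)
  have sob: "u t \<in> sobolev \<sigma>" if t: "t \<in> {0..T}" and \<sigma>: "\<sigma> \<le> r - \<rho>" for t \<sigma>
  proof -
    have "(\<lambda>\<xi>. (cmod (fourier (u t) \<xi>) * weight \<xi> powr \<sigma>)\<^sup>2) summable_on UNIV"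
    proof (rule summable_on_comparison_test[OF DG[of D]])
      fix \<xi>
      have "cmod (fourier (u t) \<xi>) * weight \<xi> powr \<sigma> \<le> cmod (?u t \<xi>) * weight \<xi> powr (r - \<rho>)"
        unfolding four[OF t] by (intro mult_left_mono powr_mono \<sigma>) auto
      with bound'[OF t, of \<xi>] show "(cmod (fourier (u t) \<xi>) * weight \<xi> powr \<sigma>)\<^sup>2 \<le> (D * G \<xi>)\<^sup>2"
        by (intro power_mono) auto
    qed auto
    with sum[OF t] show ?thesis
      by (simp add: sobolev_def distr_sums_def sq_mult_weight)
  qed
  have "u \<in> C_interval T (sobolev_topology (r - 2 - \<rho>))"
  proof (rule C_interval_sobolevI)
    fix t0 assume t0: "t0 \<in> {0..T}"
    let ?s = "r - 2 - \<rho>"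
    let ?F = "\<lambda>\<xi> t. (cmod (?u t \<xi> - ?u t0 \<xi>) * weight \<xi> powr ?s)\<^sup>2"
    have "((\<lambda>t. \<Sum>\<^sub>\<infinity>\<xi>. ?F \<xi> t) \<longlongrightarrow> 0) (at t0 within {0..T})"
    \<comment> \<open>The times t and t0 each contribute at most D G(\<xi>), and the smaller
      exponent r-2-\<rho> only lowers the weight.\<close>
    proof (rule tendsto_infsum_dominated[OF _ DG[of "2 * D"]])
      fix \<xi> t assume t: "t \<in> {0..T}"
      have "cmod (?u t \<xi> - ?u t0 \<xi>) * weight \<xi> powr ?s
          \<le> (cmod (?u t \<xi>) + cmod (?u t0 \<xi>)) * weight \<xi> powr (r - \<rho>)"
        by (intro mult_mono powr_mono norm_triangle_ineq4) auto
      also have "\<dots> \<le> 2 * D * G \<xi>"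
        using bound'[OF t, of \<xi>] bound'[OF t0, of \<xi>] by (simp add: distrib_right)
      finally show "\<bar>?F \<xi> t\<bar> \<le> (2 * D * G \<xi>)\<^sup>2"
        by (simp del: power_mult_distrib add: power_mono)
    next
      fix \<xi>
      have "continuous_on {0..T} (\<lambda>t. ?u t \<xi>)"
        by (intro continuous_on_u_hat a C_interval_sobolev_fourier[OF f])
      with t0 have "((\<lambda>t. ?u t \<xi>) \<longlongrightarrow> ?u t0 \<xi>) (at t0 within {0..T})"
        by (simp add: continuous_on_def)
      then show "(?F \<xi> \<longlongrightarrow> 0) (at t0 within {0..T})"
        by (auto intro!: tendsto_eq_intros)
    qed
    then have lim: "((\<lambda>t. sqrt (\<Sum>\<^sub>\<infinity>\<xi>. ?F \<xi> t)) \<longlongrightarrow> 0) (at t0 within {0..T})"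
      using tendsto_real_sqrt by force
    \<comment> \<open>The identity is only eventual, because the coefficients of \<open>u t\<close>
      are identified through the bound on the interval.\<close>
    have "\<forall>\<^sub>F t in at t0 within {0..T}. sqrt (\<Sum>\<^sub>\<infinity>\<xi>. ?F \<xi> t)
        = sobolev_norm ?s (\<lambda>\<phi>\<in>smooth_torus. u t \<phi> - u t0 \<phi>)"
      using t0 by (auto simp: eventually_at sobolev_norm_diff_eq four intro!: exI[of _ 1])
    with lim show "((\<lambda>t. sobolev_norm ?s (\<lambda>\<phi>\<in>smooth_torus. u t \<phi> - u t0 \<phi>)) \<longlongrightarrow> 0) (at t0 within {0..T})"
      by (rule Lim_transform_eventually)
  qed (auto intro: sob)
  with sum sob show ?thesis by blast
qed

section \<open>Gevrey spaces\<close>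

text \<open>One term of the exponential series gives z^k <= k! exp(z). Raising this to the power s
  produces the Gevrey factor.\<close>

lemma power_le_exp_gevrey:
  fixes s \<delta> x :: real
  assumes s: "s \<ge> 1" and d: "\<delta> > 0" and x: "x \<ge> 0"
  shows "x ^ k \<le> ((s / \<delta>) powr s) ^ k * fact k powr s * exp (\<delta> * x powr (1 / s))"
proof (cases "x = 0")
  case True
  then show ?thesis using s by (cases k) auto
next
  case False
  with x have x: "x > 0" by simp
  define y where "y = x powr (1 / s)"
  have y: "y > 0" using x by (simp add: y_def)
  \<comment> \<open>The factor \<delta>/s is chosen so that the s-th power of exp(z) is exp(\<delta>
    y).\<close>
  define z where "z = \<delta> / s * y"
  have z: "z \<ge> 0" using s d y by (simp add: z_def)
  have "(\<Sum>n\<in>{k}. z ^ n /\<^sub>R fact n) \<le> exp z"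
    unfolding exp_def using z by (intro sum_le_suminf summable_exp_generic) auto
  then have "z ^ k \<le> fact k * exp z" by (simp add: field_simps)
  then have "(s / \<delta>) ^ k * z ^ k \<le> (s / \<delta>) ^ k * (fact k * exp z)"
    using s d by (intro mult_left_mono) auto
  moreover have "(s / \<delta>) ^ k * z ^ k = y ^ k"
    using s d by (simp add: z_def flip: power_mult_distrib)
  ultimately have "y ^ k \<le> (s / \<delta>) ^ k * fact k * exp z" by simp
  then have "(y ^ k) powr s \<le> ((s / \<delta>) ^ k * fact k * exp z) powr s"
    using s y by (intro powr_mono2) auto
  also have "\<dots> = ((s / \<delta>) ^ k) powr s * fact k powr s * exp z powr s"
    using s d by (simp add: powr_mult)
  also have "exp z powr s = exp (\<delta> * y)"
    using s by (simp add: powr_def z_def)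
  also have "((s / \<delta>) ^ k) powr s = ((s / \<delta>) powr s) ^ k"
    using s d by (simp add: powr_realpow[symmetric] powr_powr mult.commute)
  also have "(y ^ k) powr s = x ^ k"
    using s x y by (simp add: powr_realpow[symmetric] powr_powr y_def)
  finally show ?thesis by (simp add: y_def)
qed

lemma weight_power_le_exp:
  assumes s: "s \<ge> 1" and d: "\<delta> > 0"
  obtains K where "K > 0" "\<And>\<xi>. weight \<xi> ^ m \<le> K * exp (\<delta> * norm (freq \<xi>) powr (1 / s))"
proof
  define L where "L = ((s / \<delta>) powr s) ^ m * fact m powr s"
  \<comment> \<open>Origin of the witness: 1+x <= 2 max(1,x) yields 2^m, the summand 1 covers x <=
    1, and \<open>L\<close> is the constant for x^m.\<close>
  show "2 ^ m * (1 + L) > 0"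
    by (simp add: L_def add_pos_nonneg)
  fix \<xi> :: "int ^ 'a"
  let ?x = "norm (freq \<xi>)" and ?e = "exp (\<delta> * norm (freq \<xi>) powr (1 / s))"
  have "weight \<xi> ^ m \<le> (2 * max 1 ?x) ^ m"
    by (intro power_mono) auto
  also have "\<dots> \<le> 2 ^ m * (1 + ?x ^ m)"
    by (auto simp: power_mult_distrib max_def)
  also have "\<dots> \<le> 2 ^ m * (?e + L * ?e)"
    using power_le_exp_gevrey[OF s d, of ?x m] d
    by (intro mult_left_mono add_mono) (auto simp: L_def)
  finally show "weight \<xi> ^ m \<le> 2 ^ m * (1 + L) * ?e" by (simp add: algebra_simps)
qed

lemma summable_exp_gevrey:
  assumes "s \<ge> 1" "\<delta> > 0"
  shows "(\<lambda>\<xi>::int ^ 'n::finite. exp (- \<delta> * norm (freq \<xi>) powr (1 / s)) * weight \<xi> ^ k) summable_on UNIV"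
proof -
  \<comment> \<open>Besides the given power k, the exponential absorbs 2N more powers, which make
    the series converge.\<close>
  obtain K where K: "K > 0" "\<And>\<xi> :: int ^ 'n. weight \<xi> ^ (k + 2 * CARD('n))
      \<le> K * exp (\<delta> * norm (freq \<xi>) powr (1 / s))"
    by (rule weight_power_le_exp[OF assms, where m = "k + 2 * CARD('n)"]) blast
  show ?thesis
  proof (rule summable_on_comparison_test)
    show "(\<lambda>\<xi>::int ^ 'n. K * (1 / weight \<xi> ^ (2 * CARD('n)))) summable_on UNIV"
      by (intro summable_on_cmult_right summable_weight) simp
    fix \<xi> :: "int ^ 'n"
    have "exp (- \<delta> * norm (freq \<xi>) powr (1 / s)) * weight \<xi> ^ (k + 2 * CARD('n)) \<le> K"
      using K(2)[of \<xi>] by (simp add: exp_minus field_simps)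
    then show "exp (- \<delta> * norm (freq \<xi>) powr (1 / s)) * weight \<xi> ^ k \<le> K * (1 / weight \<xi> ^ (2 * CARD('n)))"
      by (simp add: power_add pos_le_divide_eq mult.assoc)
  qed auto
qed

lemma rapid_exp_gevrey:
  assumes "s \<ge> 1" "\<delta> > 0" and c: "\<And>\<xi>. cmod (c \<xi>) \<le> C * exp (- \<delta> * norm (freq \<xi>) powr (1 / s))"
  shows "rapid c"
  unfolding rapid_def
proof
  fix k
  show "(\<lambda>\<xi>. cmod (c \<xi>) * weight \<xi> ^ k) summable_on UNIV"
  proof (rule summable_on_comparison_test[OF summable_on_cmult_right[OF summable_exp_gevrey[OF assms(1,2)]]])
    show "cmod (c \<xi>) * weight \<xi> ^ k \<le> C * (exp (- \<delta> * norm (freq \<xi>) powr (1 / s)) * weight \<xi> ^ k)" for \<xi>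
      unfolding mult.assoc[symmetric] by (intro mult_right_mono c) auto
  qed auto
qed

text \<open>Passes from the extended real supremum of quotients to pointwise real bounds, in which
  all later estimates are done.\<close>

lemma gevrey_norm_le_iff:
  assumes "h > 0" "S \<ge> 0"
  shows "gevrey_norm h s f \<le> ennreal S \<longleftrightarrow>
    (\<forall>\<alpha> x. cmod (mi_deriv \<alpha> f x) \<le> S * (h ^ mi_order \<alpha> * fact (mi_order \<alpha>) powr s))"
proof -
  have *: "X / ennreal b \<le> ennreal S \<longleftrightarrow> X \<le> ennreal (S * b)" if "b > 0" for X b
  proof -
    have "X / ennreal b \<le> ennreal S \<longleftrightarrow> X \<le> ennreal S * ennreal b"
    proof
      assume "X / ennreal b \<le> ennreal S"
      then have "X / ennreal b * ennreal b \<le> ennreal S * ennreal b"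
        by (rule mult_right_mono) simp
      then show "X \<le> ennreal S * ennreal b"
        using that by (simp add: ennreal_divide_times ennreal_mult_divide_eq divide_eq_1_ennreal)
    next
      assume "X \<le> ennreal S * ennreal b"
      then show "X / ennreal b \<le> ennreal S"
        using that by (intro divide_le_posI_ennreal) (auto simp: mult.commute)
    qed
    then show ?thesis using assms(2) that by (simp add: ennreal_mult)
  qed
  show ?thesis
    unfolding gevrey_norm_def using assms
    by (simp add: SUP_le_iff * ennreal_le_iff zero_less_mult_iff)
qed

lemma gevrey_step_subset:
  assumes "h > 0"
  shows "gevrey_step h s \<subseteq> gevrey s"
proof
  fix f :: "real ^ 'n::finite \<Rightarrow> complex" assume f: "f \<in> gevrey_step h s"
  define S where "S = enn2real (gevrey_norm h s f)"
  have "gevrey_norm h s f \<le> ennreal S"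
    using f by (simp add: gevrey_step_def S_def)
  then have S: "cmod (mi_deriv \<alpha> f x) \<le> S * (h ^ mi_order \<alpha> * fact (mi_order \<alpha>) powr s)" for \<alpha> x
    using gevrey_norm_le_iff[OF assms, of S s f] by (simp add: S_def)
  \<comment> \<open>\<open>gevrey\<close> asks for a strictly positive constant, whereas the norm
    may be 0; hence S + 1.\<close>
  have "cmod (mi_deriv \<alpha> f x) \<le> (S + 1) * h ^ mi_order \<alpha> * fact (mi_order \<alpha>) powr s" for \<alpha> x
  proof -
    have "S * (h ^ mi_order \<alpha> * fact (mi_order \<alpha>) powr s) \<le> (S + 1) * (h ^ mi_order \<alpha> * fact (mi_order \<alpha>) powr s)"
      using assms by (intro mult_right_mono) auto
    with S[of \<alpha> x] show ?thesis by simp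
  qed
  moreover have "S + 1 > 0" by (simp add: S_def add_nonneg_pos)
  ultimately show "f \<in> gevrey s"
    using f assms unfolding gevrey_def gevrey_step_def by blast
qed

section \<open>Linear structure and topology of Gevrey spaces\<close>

lemma mi_deriv_linear:
  assumes "\<phi> \<in> smooth_torus" "\<psi> \<in> smooth_torus"
  shows "mi_deriv \<alpha> (\<lambda>x. a * \<phi> x + b * \<psi> x) = (\<lambda>x. a * mi_deriv \<alpha> \<phi> x + b * mi_deriv \<alpha> \<psi> x)"
  unfolding mi_deriv_def by (rule partial_derivs_linear[OF assms])

lemma gevrey_linear:
  assumes "\<phi> \<in> gevrey s" "\<psi> \<in> gevrey s"
  shows "(\<lambda>x. a * \<phi> x + b * \<psi> x) \<in> gevrey s"
proof -
  obtain C h where 1: "C > 0" "h > 0"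
      "\<And>\<alpha> x. cmod (mi_deriv \<alpha> \<phi> x) \<le> C * h ^ mi_order \<alpha> * fact (mi_order \<alpha>) powr s"
    using assms(1) unfolding gevrey_def by blast
  obtain C' h' where 2: "C' > 0" "h' > 0"
      "\<And>\<alpha> x. cmod (mi_deriv \<alpha> \<psi> x) \<le> C' * h' ^ mi_order \<alpha> * fact (mi_order \<alpha>) powr s"
    using assms(2) unfolding gevrey_def by blast
  have sm: "\<phi> \<in> smooth_torus" "\<psi> \<in> smooth_torus" using assms by (auto simp: gevrey_def)
  define H where "H = max h h'"
  \<comment> \<open>The summand 1 keeps the constant positive when both coefficients vanish.\<close>
  define B where "B = cmod a * C + cmod b * C' + 1"
  have "cmod (a * mi_deriv \<alpha> \<phi> x + b * mi_deriv \<alpha> \<psi> x) \<le> B * H ^ mi_order \<alpha> * fact (mi_order \<alpha>) powr s"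
    for \<alpha> x
  proof -
    let ?w = "\<lambda>h. h ^ mi_order \<alpha> * fact (mi_order \<alpha>) powr s"
    have w: "?w h \<le> ?w H" "?w h' \<le> ?w H"
      using 1(2) 2(2) by (auto simp: H_def intro!: mult_right_mono power_mono)
    have "cmod (a * mi_deriv \<alpha> \<phi> x + b * mi_deriv \<alpha> \<psi> x)
        \<le> cmod a * cmod (mi_deriv \<alpha> \<phi> x) + cmod b * cmod (mi_deriv \<alpha> \<psi> x)"
      by (metis norm_mult norm_triangle_ineq)
    also have "\<dots> \<le> cmod a * (C * ?w H) + cmod b * (C' * ?w H)"
    proof (intro add_mono mult_left_mono)
      show "cmod (mi_deriv \<alpha> \<phi> x) \<le> C * ?w H"
        using 1(3)[of \<alpha> x] mult_left_mono[OF w(1) less_imp_le[OF 1(1)]]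
        by (simp only: mult.assoc)
      show "cmod (mi_deriv \<alpha> \<psi> x) \<le> C' * ?w H"
        using 2(3)[of \<alpha> x] mult_left_mono[OF w(2) less_imp_le[OF 2(1)]]
        by (simp only: mult.assoc)
    qed auto
    also have "\<dots> \<le> B * ?w H"
      using 1(2) by (simp add: B_def algebra_simps H_def)
    finally show ?thesis by simp
  qed
  moreover have "B > 0" "H > 0"
    using 1 2 by (auto simp: B_def H_def intro!: add_nonneg_pos)
  ultimately show ?thesis
    unfolding gevrey_def
    using smooth_torus_linear[OF sm, of a b] by (auto simp: mi_deriv_linear[OF sm])
qed

text \<open>The whole space as a zero neighbourhood, which makes it open and thus the carrier of its
  topology.\<close>

lemma gevrey_nhd0_gevrey: "gevrey_nhd0 s (gevrey s)"
  unfolding gevrey_nhd0_def using gevrey_step_subset gevrey_linear by (blast intro: zero_less_one)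

lemma topspace_gevrey_topology: "topspace (gevrey_topology s) = gevrey s"
proof
  show "topspace (gevrey_topology s) \<subseteq> gevrey s"
    using openin_topspace openin_gevrey_topology unfolding gevrey_open_def by blast
  have "gevrey_open s (gevrey s)"
    unfolding gevrey_open_def
    using gevrey_nhd0_gevrey[of s] gevrey_linear[of _ s _ 1 1] by auto
  then show "gevrey s \<subseteq> topspace (gevrey_topology s)"
    using openin_gevrey_topology openin_subset by blast
qed

section \<open>Fourier coefficients as continuous functionals on Gevrey spaces\<close>

lemma distr_of_commute:
  "f \<in> smooth_torus \<Longrightarrow> g \<in> smooth_torus \<Longrightarrow> distr_of f g = distr_of g f"
  by (simp add: distr_of_def mult.commute)

lemma fourier_distr_of_eq:
  "f \<in> smooth_torus \<Longrightarrow> fourier (distr_of f) \<xi> = distr_of (expi (- \<xi>)) f"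
  by (simp add: fourier_eq distr_of_commute expi_in_smooth_torus)

lemma fourier_distr_of_linear:
  assumes "f \<in> smooth_torus" "g \<in> smooth_torus"
  shows "fourier (distr_of (\<lambda>x. a * f x + b * g x)) \<xi> = a * fourier (distr_of f) \<xi> + b * fourier (distr_of g) \<xi>"
  using assms by (simp add: fourier_distr_of_eq smooth_torus_linear distr_of_linear continuous_on_expi continuous_on_id)

lemma cmod_fourier_distr_of_le:
  assumes "h > 0" "S \<ge> 0" "f \<in> smooth_torus" "gevrey_norm h s f \<le> ennreal S"
  shows "cmod (fourier (distr_of f) \<xi>) \<le> S"
proof -
  have "cmod (f x) \<le> S" for x
  proof -
    have "cmod (mi_deriv (\<lambda>_. 0) f x) \<le> S * (h ^ mi_order (\<lambda>_ :: 'a. 0) * fact (mi_order (\<lambda>_ :: 'a. 0)) powr s)"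
      using assms gevrey_norm_le_iff by blast
    then show ?thesis by (simp add: mi_deriv_zero mi_order_def)
  qed
  then show ?thesis
    unfolding fourier_distr_of_eq[OF assms(3)]
    by (intro cmod_distr_of_le assms continuous_on_expi continuous_on_id) (simp add: norm_mult)
qed

text \<open>The radius in \<open>gevrey_nhd0\<close> is an extended real and may be infinite;
  estimates need a real one.\<close>

lemma ennreal_pos_real_lower:
  assumes "(e :: ennreal) > 0"
  obtains d where "d > 0" "ennreal d \<le> e"
proof (cases e)
  case (real r)
  with assms that[of r] show ?thesis by simp
qed (use that[of 1] in simp)

text \<open>The functions whose coefficient has modulus below e form an absolutely convex set. It
  contains a ball of every step, since a coefficient is bounded by the sup norm and so by each
  Gevrey norm.\<close>

lemma continuous_map_gevrey_fourier:
  "continuous_map (gevrey_topology s) euclidean (\<lambda>f. fourier (distr_of f) \<xi>)"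
  unfolding continuous_map_def
proof (intro conjI allI impI)
  fix W :: "complex set" assume "openin euclidean W"
  then have W: "open W" by simp
  show "openin (gevrey_topology s) {f \<in> topspace (gevrey_topology s). fourier (distr_of f) \<xi> \<in> W}"
    unfolding openin_gevrey_topology topspace_gevrey_topology gevrey_open_def
  proof (intro conjI ballI)
    fix v :: "real ^ 'a \<Rightarrow> complex" assume "v \<in> {f \<in> gevrey s. fourier (distr_of f) \<xi> \<in> W}"
    then have v: "v \<in> gevrey s" "fourier (distr_of v) \<xi> \<in> W" by auto
    with W obtain e where e: "e > 0" "\<And>y. dist y (fourier (distr_of v) \<xi>) < e \<Longrightarrow> y \<in> W"
      unfolding open_dist by blast
    define U where "U = {\<phi> \<in> gevrey s. cmod (fourier (distr_of \<phi>) \<xi>) < e}"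
    have sm: "\<phi> \<in> smooth_torus" if "\<phi> \<in> gevrey s" for \<phi> using that by (simp add: gevrey_def)
    have "gevrey_nhd0 s U"
      unfolding gevrey_nhd0_def
    proof (intro conjI ballI allI impI)
      fix \<phi> \<psi> a b assume *: "\<phi> \<in> U" "\<psi> \<in> U" "cmod a + cmod b \<le> 1"
      \<comment> \<open>The maximum stays strictly below e and dominates the combination, because
        the moduli of a and b add up to at most 1.\<close>
      let ?m = "max (cmod (fourier (distr_of \<phi>) \<xi>)) (cmod (fourier (distr_of \<psi>) \<xi>))"
      have "cmod (fourier (distr_of (\<lambda>x. a * \<phi> x + b * \<psi> x)) \<xi>)
          \<le> cmod a * cmod (fourier (distr_of \<phi>) \<xi>) + cmod b * cmod (fourier (distr_of \<psi>) \<xi>)"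
        using * norm_triangle_ineq[of "a * fourier (distr_of \<phi>) \<xi>" "b * fourier (distr_of \<psi>) \<xi>"]
          fourier_distr_of_linear[OF sm sm, of \<phi> \<psi> a b \<xi>]
        by (simp add: U_def norm_mult)
      also have "\<dots> \<le> cmod a * ?m + cmod b * ?m"
        by (intro add_mono mult_left_mono) auto
      also have "\<dots> \<le> ?m"
        using *(3) mult_right_mono[OF *(3), of ?m] by (simp add: distrib_right le_max_iff_disj)
      also have "?m < e" using * by (simp add: U_def)
      finally show "(\<lambda>x. a * \<phi> x + b * \<psi> x) \<in> U"
        using * gevrey_linear by (auto simp: U_def)
    next
      fix h :: real assume h: "h > 0"
      show "\<exists>\<epsilon>>0. \<forall>\<phi>\<in>gevrey_step h s. gevrey_norm h s \<phi> < \<epsilon> \<longrightarrow> \<phi> \<in> U"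
      proof (intro exI[of _ "ennreal (e / 2)"] conjI ballI impI)
        fix \<phi> :: "real ^ 'a \<Rightarrow> complex"
        assume \<phi>: "\<phi> \<in> gevrey_step h s" "gevrey_norm h s \<phi> < ennreal (e / 2)"
        then have "cmod (fourier (distr_of \<phi>) \<xi>) \<le> e / 2"
          using e h by (intro cmod_fourier_distr_of_le[of h _ _ s]) (auto simp: gevrey_step_def)
        then show "\<phi> \<in> U"
          using e \<phi> gevrey_step_subset[OF h] by (auto simp: U_def)
      qed (use e in simp)
    qed (auto simp: U_def)
    moreover have "(\<lambda>x. v x + \<phi> x) \<in> {f \<in> gevrey s. fourier (distr_of f) \<xi> \<in> W}" if "\<phi> \<in> U" for \<phi>
      using that v gevrey_linear[of v s \<phi> 1 1] fourier_distr_of_linear[of v \<phi> 1 1 \<xi>]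
      by (auto simp: U_def dist_norm sm intro!: e(2))
    ultimately show "\<exists>U. gevrey_nhd0 s U \<and>
        (\<forall>\<phi>\<in>U. (\<lambda>x. v x + \<phi> x) \<in> {f \<in> gevrey s. fourier (distr_of f) \<xi> \<in> W})" by blast
  qed auto
qed auto

text \<open>A derivative of order k costs |\<xi>|^k, which the exponential weight pays for up to h^k
  k!^s. The same h works for all orders, so the series lies in a single step.\<close>

lemma gevrey_norm_trig_series_le:
  fixes c :: "int ^ 'n::finite \<Rightarrow> complex"
  assumes s: "s \<ge> 1" and d: "\<delta> > 0" and c: "rapid c"
    and sum: "(\<lambda>\<xi>. cmod (c \<xi>) * exp (\<delta> * norm (freq \<xi>) powr (1 / s))) summable_on UNIV"
  shows "gevrey_norm ((s / \<delta>) powr s) s (trig_series c)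
    \<le> ennreal (\<Sum>\<^sub>\<infinity>\<xi>. cmod (c \<xi>) * exp (\<delta> * norm (freq \<xi>) powr (1 / s)))"
proof (subst gevrey_norm_le_iff)
  let ?h = "(s / \<delta>) powr s" and ?e = "\<lambda>\<xi>. exp (\<delta> * norm (freq \<xi>) powr (1 / s))"
  show "\<forall>\<alpha> x. cmod (mi_deriv \<alpha> (trig_series c) x)
      \<le> (\<Sum>\<^sub>\<infinity>\<xi>. cmod (c \<xi>) * ?e \<xi>) * (?h ^ mi_order \<alpha> * fact (mi_order \<alpha>) powr s)"
  proof (intro allI)
    fix \<alpha> :: "'n \<Rightarrow> nat" and x :: "real ^ 'n"
    let ?k = "mi_order \<alpha>"
    obtain js where js: "length js = ?k" "mi_deriv \<alpha> (trig_series c) = partial_derivs js (trig_series c)"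
      by (metis mi_deriv_list)
    have "cmod (mi_deriv \<alpha> (trig_series c) x) \<le> (\<Sum>\<^sub>\<infinity>\<xi>. cmod (c \<xi>) * norm (freq \<xi>) ^ ?k)"
      using cmod_partial_derivs_trig_series_le[OF c, of js x] js by simp
    also have "\<dots> \<le> (\<Sum>\<^sub>\<infinity>\<xi>. cmod (c \<xi>) * ?e \<xi> * (?h ^ ?k * fact ?k powr s))"
    proof (rule infsum_mono)
      show "(\<lambda>\<xi>. cmod (c \<xi>) * norm (freq \<xi>) ^ ?k) summable_on UNIV"
        by (rule rapid_summable(2)[OF c, of _ 1 ?k])
           (auto simp: norm_mult norm_power intro!: mult_left_mono power_mono)
      show "(\<lambda>\<xi>. cmod (c \<xi>) * ?e \<xi> * (?h ^ ?k * fact ?k powr s)) summable_on UNIV"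
        by (intro summable_on_cmult_left sum)
      fix \<xi>
      have "cmod (c \<xi>) * norm (freq \<xi>) ^ ?k \<le> cmod (c \<xi>) * (?h ^ ?k * fact ?k powr s * ?e \<xi>)"
        by (intro mult_left_mono power_le_exp_gevrey s d) auto
      then show "cmod (c \<xi>) * norm (freq \<xi>) ^ ?k \<le> cmod (c \<xi>) * ?e \<xi> * (?h ^ ?k * fact ?k powr s)"
        by (simp add: mult_ac)
    qed
    finally show "cmod (mi_deriv \<alpha> (trig_series c) x)
        \<le> (\<Sum>\<^sub>\<infinity>\<xi>. cmod (c \<xi>) * ?e \<xi>) * (?h ^ ?k * fact ?k powr s)"
      by (simp add: infsum_cmult_left')
  qed
qed (use s d in \<open>auto intro!: infsum_nonneg\<close>)

text \<open>Half of the decay rate \<delta> is spent on the Gevrey norm and the other half on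
  summability. Thus \<open>u\<close> lives in one step, and continuity there passes to the inductive
  limit because each zero neighbourhood contains a ball of that step.\<close>

lemma gevrey_solution:
  fixes f :: "real \<Rightarrow> real ^ 'n::finite \<Rightarrow> complex"
  assumes a: "continuous_on {0..T} a\<^sub>2" "\<And>j. continuous_on {0..T} (a\<^sub>1 j)" "continuous_on {0..T} a\<^sub>0"
    and s: "s \<ge> 1" and f: "f \<in> C_interval T (gevrey_topology s)" and d: "\<delta> > 0"
    and bound: "\<And>t \<xi>. t \<in> {0..T} \<Longrightarrow> cmod (u_hat a\<^sub>2 a\<^sub>1 a\<^sub>0 (\<lambda>\<tau>. fourier (distr_of (f \<tau>))) g_hat t \<xi>)
        \<le> C * exp (- \<delta> * norm (freq \<xi>) powr (1 / s))"
  shows "\<exists>u. (\<forall>t\<in>{0..T}. \<forall>x.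
              ((\<lambda>\<xi>. u_hat a\<^sub>2 a\<^sub>1 a\<^sub>0 (\<lambda>\<tau>. fourier (distr_of (f \<tau>))) g_hat t \<xi> * expi \<xi> x)
                 has_sum u t x) UNIV) \<and> u \<in> C_interval T (gevrey_topology s)"
proof -
  let ?u = "u_hat a\<^sub>2 a\<^sub>1 a\<^sub>0 (\<lambda>\<tau>. fourier (distr_of (f \<tau>))) g_hat"
  let ?y = "\<lambda>\<xi> :: int ^ 'n. norm (freq \<xi>) powr (1 / s)"
  define h where "h = (s / (\<delta> / 2)) powr s"
  have h: "h > 0" using s d by (simp add: h_def)
  have rap: "rapid (?u t)" if "t \<in> {0..T}" for t
    using rapid_exp_gevrey[OF s d bound[OF that]] .
  have half: "B * exp (- \<delta> * ?y \<xi>) * exp (\<delta> / 2 * ?y \<xi>) = B * exp (- (\<delta> / 2) * ?y \<xi>)" for B \<xi>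
    by (simp add: mult.assoc flip: exp_add)
  have halfsum: "(\<lambda>\<xi>. B * exp (- (\<delta> / 2) * ?y \<xi>)) summable_on UNIV" for B
    using summable_exp_gevrey[OF s, of "\<delta> / 2" 0] d by (intro summable_on_cmult_right) simp
  have norm_le: "trig_series c \<in> gevrey_step h s"
      "gevrey_norm h s (trig_series c) \<le> ennreal (\<Sum>\<^sub>\<infinity>\<xi>. cmod (c \<xi>) * exp (\<delta> / 2 * ?y \<xi>))"
    if c: "\<And>\<xi>. cmod (c \<xi>) \<le> B * exp (- \<delta> * ?y \<xi>)" for c B
  proof -
    have r: "rapid c" by (rule rapid_exp_gevrey[OF s d c])
    have "(\<lambda>\<xi>. cmod (c \<xi>) * exp (\<delta> / 2 * ?y \<xi>)) summable_on UNIV"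
    proof (rule summable_on_comparison_test[OF halfsum])
      show "cmod (c \<xi>) * exp (\<delta> / 2 * ?y \<xi>) \<le> B * exp (- (\<delta> / 2) * ?y \<xi>)" for \<xi>
        unfolding half[symmetric] by (intro mult_right_mono c) simp
    qed simp
    with gevrey_norm_trig_series_le[OF s _ r, of "\<delta> / 2"] d
    show le: "gevrey_norm h s (trig_series c) \<le> ennreal (\<Sum>\<^sub>\<infinity>\<xi>. cmod (c \<xi>) * exp (\<delta> / 2 * ?y \<xi>))"
      by (simp add: h_def)
    then show "trig_series c \<in> gevrey_step h s"
      using trig_series_in_smooth_torus[OF r] le_less_trans[OF le ennreal_less_top]
      by (simp add: gevrey_step_def)
  qed
  define u where "u t = trig_series (?u t)" for t
  have "u \<in> C_interval T (gevrey_topology s)"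
  proof (rule C_intervalI)
    show "u t \<in> topspace (gevrey_topology s)" if "t \<in> {0..T}" for t
      using norm_le(1)[OF bound[OF that]] gevrey_step_subset[OF h]
      by (auto simp: topspace_gevrey_topology u_def)
    fix V t0 assume "openin (gevrey_topology s) V" and t0: "t0 \<in> {0..T}" "u t0 \<in> V"
    then obtain U where U: "gevrey_nhd0 s U" "\<And>\<phi>. \<phi> \<in> U \<Longrightarrow> (\<lambda>x. u t0 x + \<phi> x) \<in> V"
      unfolding openin_gevrey_topology gevrey_open_def by blast
    then obtain \<epsilon> where \<epsilon>0: "\<epsilon> > 0" and \<epsilon>: "\<And>\<phi>. \<phi> \<in> gevrey_step h s \<Longrightarrow> gevrey_norm h s \<phi> < \<epsilon> \<Longrightarrow> \<phi> \<in> U"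
      using h unfolding gevrey_nhd0_def by blast
    obtain e where e: "e > 0" "ennreal e \<le> \<epsilon>" by (rule ennreal_pos_real_lower[OF \<epsilon>0])
    let ?F = "\<lambda>\<xi> t. cmod (?u t \<xi> - ?u t0 \<xi>) * exp (\<delta> / 2 * ?y \<xi>)"
    \<comment> \<open>The difference of two times satisfies the same decay with constant 2C, so
      \<open>norm_le\<close> applies to its series as well.\<close>
    have diff: "cmod (?u t \<xi> - ?u t0 \<xi>) \<le> (2 * C) * exp (- \<delta> * ?y \<xi>)" if "t \<in> {0..T}" for t \<xi>
      using norm_triangle_ineq4[of "?u t \<xi>" "?u t0 \<xi>"] bound[OF that, of \<xi>] bound[OF t0(1), of \<xi>]
      by simp
    have "((\<lambda>t. \<Sum>\<^sub>\<infinity>\<xi>. ?F \<xi> t) \<longlongrightarrow> 0) (at t0 within {0..T})"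
    proof (rule tendsto_infsum_dominated[OF _ halfsum[of "2 * C"]])
      show "\<bar>?F \<xi> t\<bar> \<le> 2 * C * exp (- (\<delta> / 2) * ?y \<xi>)" if "t \<in> {0..T}" for \<xi> t
        unfolding half[symmetric] using diff[OF that, of \<xi>] by (simp add: abs_mult mult_right_mono)
      fix \<xi>
      have "continuous_on {0..T} (\<lambda>t. ?u t \<xi>)"
        by (intro continuous_on_u_hat a C_interval_continuous_on[OF f] continuous_map_gevrey_fourier)
      with t0 have "((\<lambda>t. ?u t \<xi>) \<longlongrightarrow> ?u t0 \<xi>) (at t0 within {0..T})"
        by (simp add: continuous_on_def)
      then show "(?F \<xi> \<longlongrightarrow> 0) (at t0 within {0..T})"
        by (auto intro!: tendsto_eq_intros)
    qed
    then have "\<forall>\<^sub>F t in at t0 within {0..T}. (\<Sum>\<^sub>\<infinity>\<xi>. ?F \<xi> t) < e"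
      using e(1) by (rule order_tendstoD(2))
    moreover have "\<forall>\<^sub>F t in at t0 within {0..T}. t \<in> {0..T}"
      by (auto simp: eventually_at intro: exI[of _ 1])
    ultimately show "\<forall>\<^sub>F t in at t0 within {0..T}. u t \<in> V"
    proof eventually_elim
      case (elim t)
      let ?\<phi> = "trig_series (\<lambda>\<xi>. ?u t \<xi> - ?u t0 \<xi>)"
      have "ennreal (\<Sum>\<^sub>\<infinity>\<xi>. ?F \<xi> t) < ennreal e"
        using elim(1) e(1) by (simp add: ennreal_lessI)
      then have "gevrey_norm h s ?\<phi> < \<epsilon>"
        using norm_le(2)[OF diff[OF elim(2)]] e(2) by (meson le_less_trans less_le_trans)
      then have "?\<phi> \<in> U"
        by (intro \<epsilon> norm_le(1)[OF diff[OF elim(2)]])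
      moreover have "u t = (\<lambda>x. u t0 x + ?\<phi> x)"
      proof
        fix x
        have "((\<lambda>\<xi>. ?u t0 \<xi> * expi \<xi> x + (?u t \<xi> - ?u t0 \<xi>) * expi \<xi> x) has_sum (u t0 x + ?\<phi> x)) UNIV"
          unfolding u_def
          by (intro has_sum_add rapid_has_sum rap t0 rapid_exp_gevrey[OF s d diff[OF elim(2)]])
        then have "((\<lambda>\<xi>. ?u t \<xi> * expi \<xi> x) has_sum (u t0 x + ?\<phi> x)) UNIV"
          by (simp add: algebra_simps)
        with rapid_has_sum[OF rap[OF elim(2)]] show "u t x = u t0 x + ?\<phi> x"
          unfolding u_def by (rule has_sum_unique)
      qed
      ultimately show ?case using U(2)[of ?\<phi>] by (simp only:)
    qed
  qed
  moreover have "\<forall>t\<in>{0..T}. \<forall>x. ((\<lambda>\<xi>. ?u t \<xi> * expi \<xi> x) has_sum u t x) UNIV"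
    unfolding u_def using rapid_has_sum[OF rap] by blast
  ultimately show ?thesis by blast
qed

section \<open>The Sobolev and Gevrey cases combined\<close>

theorem lemma4p1:
  fixes T :: real
    and a\<^sub>2 a\<^sub>0 :: "real \<Rightarrow> complex"
    and a\<^sub>1 :: "'n::finite \<Rightarrow> real \<Rightarrow> complex"
  assumes "T > 0"
    and "continuous_on {0..T} a\<^sub>2"
    and "\<And>j. continuous_on {0..T} (a\<^sub>1 j)"
    and "continuous_on {0..T} a\<^sub>0"
  shows
    "(\<forall>(r::real) (f :: real \<Rightarrow> 'n functional) (g :: 'n functional) (C::real) (\<rho>::real).
        f \<in> C_interval T (sobolev_topology r) \<longrightarrow> g \<in> sobolev r \<longrightarrow> C > 0 \<longrightarrow> \<rho> \<ge> 0 \<longrightarrow>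
        (\<forall>t\<in>{0..T}. \<forall>\<xi>.
           cmod (u_hat a\<^sub>2 a\<^sub>1 a\<^sub>0 (\<lambda>s. fourier (f s)) (fourier g) t \<xi>)
             \<le> C * (1 + norm (freq \<xi>)) powr \<rho> *
               (cmod (fourier g \<xi>) + sqrt (integral {0..T} (\<lambda>s. (cmod (fourier (f s) \<xi>))\<^sup>2)))) \<longrightarrow>
        (\<exists>u :: real \<Rightarrow> 'n functional.
           (\<forall>t\<in>{0..T}.
              distr_sums (u_hat a\<^sub>2 a\<^sub>1 a\<^sub>0 (\<lambda>s. fourier (f s)) (fourier g) t) (u t) \<and>
              u t \<in> sobolev (r - \<rho>)) \<and>
           u \<in> C_interval T (sobolev_topology (r - 2 - \<rho>))))
     \<and>
     (\<forall>(s::real) (f :: real \<Rightarrow> real ^ 'n \<Rightarrow> complex) (g :: real ^ 'n \<Rightarrow> complex) (C::real) (\<delta>::real).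
        s \<ge> 1 \<longrightarrow> f \<in> C_interval T (gevrey_topology s) \<longrightarrow> g \<in> gevrey s \<longrightarrow> C > 0 \<longrightarrow> \<delta> > 0 \<longrightarrow>
        (\<forall>t\<in>{0..T}. \<forall>\<xi>.
           cmod (u_hat a\<^sub>2 a\<^sub>1 a\<^sub>0 (\<lambda>\<tau>. fourier (distr_of (f \<tau>))) (fourier (distr_of g)) t \<xi>)
             \<le> C * exp (- \<delta> * norm (freq \<xi>) powr (1 / s))) \<longrightarrow>
        (\<exists>u :: real \<Rightarrow> real ^ 'n \<Rightarrow> complex.
           (\<forall>t\<in>{0..T}. \<forall>x.
              ((\<lambda>\<xi>. u_hat a\<^sub>2 a\<^sub>1 a\<^sub>0 (\<lambda>\<tau>. fourier (distr_of (f \<tau>))) (fourier (distr_of g)) t \<xi> * expi \<xi> x)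
                 has_sum u t x) UNIV) \<and>
           u \<in> C_interval T (gevrey_topology s)))"
proof (intro conjI allI impI)
  show "\<exists>u. (\<forall>t\<in>{0..T}.
        distr_sums (u_hat a\<^sub>2 a\<^sub>1 a\<^sub>0 (\<lambda>s. fourier (f s)) (fourier g) t) (u t) \<and> u t \<in> sobolev (r - \<rho>)) \<and>
      u \<in> C_interval T (sobolev_topology (r - 2 - \<rho>))"
    if "f \<in> C_interval T (sobolev_topology r)" "g \<in> sobolev r"
      "\<forall>t\<in>{0..T}. \<forall>\<xi>. cmod (u_hat a\<^sub>2 a\<^sub>1 a\<^sub>0 (\<lambda>s. fourier (f s)) (fourier g) t \<xi>)
         \<le> C * weight \<xi> powr \<rho> *
           (cmod (fourier g \<xi>) + sqrt (integral {0..T} (\<lambda>s. (cmod (fourier (f s) \<xi>))\<^sup>2)))"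
    for r \<rho> C :: real and f :: "real \<Rightarrow> 'n functional" and g :: "'n functional"
    using that by (intro sobolev_solution assms) auto
  show "\<exists>u. (\<forall>t\<in>{0..T}. \<forall>x.
        ((\<lambda>\<xi>. u_hat a\<^sub>2 a\<^sub>1 a\<^sub>0 (\<lambda>\<tau>. fourier (distr_of (f \<tau>))) (fourier (distr_of g)) t \<xi> * expi \<xi> x)
           has_sum u t x) UNIV) \<and> u \<in> C_interval T (gevrey_topology s)"
    if "s \<ge> 1" "f \<in> C_interval T (gevrey_topology s)" "\<delta> > 0"
      "\<forall>t\<in>{0..T}. \<forall>\<xi>. cmod (u_hat a\<^sub>2 a\<^sub>1 a\<^sub>0 (\<lambda>\<tau>. fourier (distr_of (f \<tau>))) (fourier (distr_of g)) t \<xi>)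
         \<le> C * exp (- \<delta> * norm (freq \<xi>) powr (1 / s))"
    for s \<delta> C :: real and f :: "real \<Rightarrow> real ^ 'n \<Rightarrow> complex" and g
    using that by (intro gevrey_solution assms) auto
qed

end
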